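(* Let $V\in\mathbb{C}^{n\times n}$ have rows $v_1,\dots,v_n$, let $A=VV^\dagger$, and suppose $A\preceq I$. Assume that the maximizer $X^*$ of $$\mathrm{SDP}(V)=\max_{X\succeq 0,\ \operatorname{tr}(X)=n}\ \prod_{i=1}^n v_i^\dagger X v_i$$ (maximum over Hermitian positive semidefinite $X\in\mathbb{C}^{n\times n}$ with trace $n$) satisfies $v_i^\dagger X^*v_i=1$ for all $i\in\{1,\dots,n\}$. Then for every $0\le\beta<1$, $$\operatorname{per}(A)\ \ge\ e^{-n}\cdot r(V)\ \ge\ e^{-(\gamma+1)n}\cdot\exp\left(n\cdot\left(\ln(1-\beta)+\frac{\beta}{1-\beta}\cdot\frac{\operatorname{tr}(A)}{n}-\frac{0.273\,\beta^2}{(1-\beta)^2}\cdot\frac{n}{\operatorname{tr}(A)}\right)\right).$$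
   Context: $\operatorname{per}(A)=\sum_{\sigma\in S_n}\prod_{i=1}^n A_{i,\sigma(i)}$. $\gamma\approx 0.577$ is the Euler--Mascheroni constant. $\preceq$ is the Loewner order. Convention for rows: $v_i\in\mathbb{C}^n$ is regarded as a column vector such that the $i$-th row of $V$ is $v_i^\dagger$, so that $(Vx)_i=\langle v_i,x\rangle=v_i^\dagger x$, $A_{ij}=v_i^\dagger v_j$ and $V^\dagger V=\sum_i v_iv_i^\dagger$. Norm convention: for $x\in\mathbb{C}^n$, $\|x\|_2=\big(\frac1n\sum_{i=1}^n|x_i|^2\big)^{1/2}$ (normalized by the dimension). The quantity $r(V)$ is defined by $$r(V)=\max_{x\in\mathbb{C}^n:\ \|x\|_2=1}\ \prod_{i=1}^n|\langle v_i,x\rangle|^2 .$$ *)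

theory Defs
  imports "HOL-Analysis.Analysis"
begin

text \<open>
  An \<open>n \<times> n\<close> complex matrix is an element of \<^typ>\<open>complex ^ 'n ^ 'n\<close> with \<open>n = CARD('n)\<close>.
  The order on \<^typ>\<open>complex\<close> is the one of \<^theory>\<open>HOL-Library.Complex_Order\<close>:
  \<open>a \<le> b\<close> iff \<open>Re a \<le> Re b\<close> and \<open>Im a = Im b\<close>. In particular a complex number bounded
  below by a real number is itself real.
\<close>

definition permanent :: "'a::comm_ring_1 ^ 'n ^ 'n \<Rightarrow> 'a" where
  "permanent A = (\<Sum>\<sigma> | \<sigma> permutes UNIV. \<Prod>i\<in>UNIV. A $ i $ \<sigma> i)"

definition mat_dagger :: "complex ^ 'n ^ 'm \<Rightarrow> complex ^ 'm ^ 'n" where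
  "mat_dagger A = (\<chi> i j. cnj (A $ j $ i))"

text \<open>\<open>cdot v x = v\<^sup>\<dagger> x\<close>: conjugate-linear in the first argument.\<close>

definition cdot :: "complex ^ 'n \<Rightarrow> complex ^ 'n \<Rightarrow> complex" where
  "cdot v x = (\<Sum>j\<in>UNIV. cnj (v $ j) * x $ j)"

definition psd :: "complex ^ 'n ^ 'n \<Rightarrow> bool" where
  "psd X \<longleftrightarrow> mat_dagger X = X \<and> (\<forall>x. 0 \<le> cdot x (X *v x))"

definition loewner_le :: "complex ^ 'n ^ 'n \<Rightarrow> complex ^ 'n ^ 'n \<Rightarrow> bool"  (infix "\<preceq>\<^sub>L" 50) where
  "A \<preceq>\<^sub>L B \<longleftrightarrow> psd (B - A)"

text \<open>
  The column vector \<open>v\<^sub>i\<close> whose conjugate transpose is the \<open>i\<close>-th row of \<open>V\<close>;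
  hence the conjugation.
\<close>

definition rowvec :: "complex ^ 'n ^ 'm \<Rightarrow> 'm \<Rightarrow> complex ^ 'n" where
  "rowvec V i = (\<chi> j. cnj (V $ i $ j))"

lemma cdot_rowvec: "cdot (rowvec V i) x = (V *v x) $ i"
  by (simp add: cdot_def rowvec_def matrix_vector_mult_def)

lemma cdot_rowvec_rowvec: "cdot (rowvec V i) (rowvec V j) = (V ** mat_dagger V) $ i $ j"
  by (simp add: cdot_def rowvec_def mat_dagger_def matrix_matrix_mult_def)

text \<open>The Euclidean norm normalized by the dimension.\<close>

definition nnorm :: "complex ^ 'n \<Rightarrow> real" where
  "nnorm x = sqrt (1 / real CARD('n) * (\<Sum>i\<in>UNIV. (cmod (x $ i))\<^sup>2))"

definition r_obj :: "complex ^ 'n ^ 'n \<Rightarrow> complex ^ 'n \<Rightarrow> real" where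
  "r_obj V x = (\<Prod>i\<in>UNIV. (cmod (cdot (rowvec V i) x))\<^sup>2)"

text \<open>The supremum is a maximum by compactness, see \<open>r_max_attained\<close> below.\<close>

definition r_max :: "complex ^ 'n ^ 'n \<Rightarrow> real" where
  "r_max V = (SUP x\<in>{x. nnorm x = 1}. r_obj V x)"

lemma nnorm_eq: "nnorm (x :: complex ^ 'n) = norm x / sqrt (real CARD('n))"
  by (simp add: nnorm_def norm_vec_def L2_set_def real_sqrt_divide)

lemma r_max_attained:
  fixes V :: "complex ^ 'n ^ 'n"
  shows "\<exists>x. nnorm x = 1 \<and> r_obj V x = r_max V \<and> (\<forall>y. nnorm y = 1 \<longrightarrow> r_obj V y \<le> r_obj V x)"
proof -
  let ?S = "{x :: complex ^ 'n. nnorm x = 1}"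
  have S: "?S = sphere 0 (sqrt (real CARD('n)))"
    by (auto simp: nnorm_eq)
  have "compact ?S" "?S \<noteq> {}"
    unfolding S by (auto simp: compact_sphere)
  moreover have "continuous_on ?S (r_obj V)"
    unfolding r_obj_def cdot_def by (intro continuous_intros)
  ultimately obtain x where x: "x \<in> ?S" "\<forall>y\<in>?S. r_obj V y \<le> r_obj V x"
    using continuous_attains_sup by blast
  then have "r_max V = r_obj V x"
    unfolding r_max_def by (intro cSup_eq_maximum) auto
  with x show ?thesis by auto
qed

definition sdp_feasible :: "complex ^ 'n ^ 'n \<Rightarrow> bool" where
  "sdp_feasible X \<longleftrightarrow> psd X \<and> trace X = of_nat CARD('n)"

text \<open>The factors \<open>v\<^sub>i\<^sup>\<dagger> X v\<^sub>i\<close> are real for feasible \<open>X\<close>, so taking real parts loses nothing.\<close>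

definition sdp_obj :: "complex ^ 'n ^ 'n \<Rightarrow> complex ^ 'n ^ 'n \<Rightarrow> real" where
  "sdp_obj V X = (\<Prod>i\<in>UNIV. Re (cdot (rowvec V i) (X *v rowvec V i)))"

definition sdp_maximizer :: "complex ^ 'n ^ 'n \<Rightarrow> complex ^ 'n ^ 'n \<Rightarrow> bool" where
  "sdp_maximizer V X \<longleftrightarrow> is_arg_max (sdp_obj V) sdp_feasible X"

end

theory Submission
  imports Defs "HOL-Probability.Distributions" "HOL-Combinatorics.Permutations" "HOL-Real_Asymp.Real_Asymp"
begin

text \<open>
  The permanent of \<open>VV\<^sup>\<dagger>\<close> is up to \<open>n!\<close> the squared norm of the symmetrized tensor
  \<open>v\<^sub>1 \<otimes> \<dots> \<otimes> v\<^sub>n\<close>; Cauchy-Schwarz against \<open>x \<otimes> \<dots> \<otimes> x\<close> gives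
  \<open>per A \<ge> (n! / n\<^sup>n) r(V) \<ge> e\<^sup>-\<^sup>n r(V)\<close>.

  For the second inequality put \<open>s = \<beta> / (1 - \<beta>)\<close> and let \<open>x = G + h\<close>, where \<open>G\<close> is a complex Gaussian
  vector of covariance \<open>X\<close> and \<open>h = sqrt (s n / t) V\<^sup>\<dagger>\<epsilon>\<close> with independent uniform fourth roots of unity
  \<open>\<epsilon>\<^sub>j\<close>. Each \<open>\<langle>v\<^sub>i, G\<rangle>\<close> is a standard complex Gaussian, so that with \<open>a = |\<langle>v\<^sub>i, h\<rangle>|\<^sup>2\<close> the expectation
  of \<open>ln |\<langle>v\<^sub>i, x\<rangle>|\<^sup>2\<close> over \<open>G\<close> is at least \<open>- \<gamma> + a - a\<^sup>2 / 4\<close>, while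
  \<open>ln \<parallel>x\<parallel>\<^sup>2 \<le> (1 - \<beta>) \<parallel>x\<parallel>\<^sup>2 - 1 - ln (1 - \<beta>)\<close> in the normalized norm. Averaging over \<open>\<epsilon>\<close>, the linear
  term contributes \<open>(s n / t) \<Sum>\<^sub>i (A\<^sup>2)\<^sub>i\<^sub>i \<ge> s t\<close>. The quadratic term costs at most
  \<open>(s n / t)\<^sup>2 / 4\<close> times \<open>\<Sum>\<^sub>i (2 (A\<^sup>2)\<^sub>i\<^sub>i\<^sup>2 - A\<^sub>i\<^sub>i\<^sup>4)\<close>; since \<open>A \<preceq> I\<close> gives \<open>(A\<^sup>2)\<^sub>i\<^sub>i \<le> A\<^sub>i\<^sub>i \<le> 1\<close>,
  this sum is at most \<open>max {2 a - a\<^sup>3 | 0 \<le> a \<le> 1} t < 1.092 t\<close>, and \<open>0.273 = 1.092 / 4\<close>.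
\<close>

section \<open>The permanent and symmetric tensors\<close>

lemma cdot_add: "cdot v (x + y) = cdot v x + cdot v y"
  by (simp add: cdot_def algebra_simps sum.distrib)

lemma cdot_scale: "cdot v (z *s x) = z * cdot v x"
  by (simp add: cdot_def algebra_simps sum_distrib_left)

lemma prod_sum_UNIV:
  fixes f :: "'a::finite \<Rightarrow> 'b::finite \<Rightarrow> 'c::comm_semiring_1"
  shows "(\<Prod>i\<in>UNIV. \<Sum>k\<in>UNIV. f i k) = (\<Sum>g\<in>UNIV. \<Prod>i\<in>UNIV. f i (g i))"
  using prod_sum_PiE[of UNIV "\<lambda>_. UNIV" f] by (simp add: PiE_UNIV_domain)

text \<open>Expanding the squared norm gives a double sum over \<sigma> and \<tau>. The sum over
  \<open>f\<close> factorizes into entries of the Gram matrix, and relabelling by \<sigma> turns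
  each sum over \<tau> into the permanent, which leaves n! equal terms.\<close>

lemma gram_permanent:
  fixes V :: "complex ^ 'n ^ 'n"
  defines "S \<equiv> \<lambda>f :: 'n \<Rightarrow> 'n. \<Sum>\<sigma> | \<sigma> permutes UNIV. \<Prod>i\<in>UNIV. V $ \<sigma> i $ f i"
  shows "of_real (\<Sum>f\<in>UNIV. (cmod (S f))\<^sup>2) = fact CARD('n) * permanent (V ** mat_dagger V)"
proof -
  let ?P = "{\<sigma> :: 'n \<Rightarrow> 'n. \<sigma> permutes UNIV}"
  let ?A = "V ** mat_dagger V"
  have A: "?A $ i $ j = (\<Sum>k\<in>UNIV. V $ i $ k * cnj (V $ j $ k))" for i j
    by (simp add: matrix_matrix_mult_def mat_dagger_def)
  have "of_real (\<Sum>f\<in>UNIV. (cmod (S f))\<^sup>2) = (\<Sum>f\<in>UNIV. S f * cnj (S f))"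
    by (simp add: complex_norm_square [symmetric])
  also have "\<dots> = (\<Sum>f\<in>UNIV. \<Sum>\<sigma>\<in>?P. \<Sum>\<tau>\<in>?P. \<Prod>i\<in>UNIV. V $ \<sigma> i $ f i * cnj (V $ \<tau> i $ f i))"
    by (simp add: S_def sum_product prod.distrib)
  also have "\<dots> = (\<Sum>\<sigma>\<in>?P. \<Sum>\<tau>\<in>?P. \<Sum>f\<in>UNIV. \<Prod>i\<in>UNIV. V $ \<sigma> i $ f i * cnj (V $ \<tau> i $ f i))"
    by (subst sum.swap, rule sum.cong[OF refl], rule sum.swap)
  also have "\<dots> = (\<Sum>\<sigma>\<in>?P. \<Sum>\<tau>\<in>?P. \<Prod>i\<in>UNIV. ?A $ \<sigma> i $ \<tau> i)"
    by (simp add: A prod_sum_UNIV)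
  also have "\<dots> = (\<Sum>\<sigma>\<in>?P. permanent ?A)"
  proof (intro sum.cong refl)
    fix \<sigma> assume "\<sigma> \<in> ?P"
    then have s: "\<sigma> permutes UNIV" by simp
    have "(\<Sum>\<tau>\<in>?P. \<Prod>i\<in>UNIV. ?A $ \<sigma> i $ \<tau> i) = (\<Sum>\<tau>\<in>?P. \<Prod>i\<in>UNIV. ?A $ \<sigma> i $ (\<tau> \<circ> \<sigma>) i)"
      by (rule sum_permutations_compose_right[OF s])
    also have "\<dots> = (\<Sum>\<tau>\<in>?P. \<Prod>i\<in>UNIV. ?A $ i $ \<tau> i)"
      by (intro sum.cong refl, simp add: prod.permute[OF s, of "\<lambda>i. ?A $ i $ _ i"] o_def)
    finally show "(\<Sum>\<tau>\<in>?P. \<Prod>i\<in>UNIV. ?A $ \<sigma> i $ \<tau> i) = permanent ?A"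
      by (simp add: permanent_def)
  qed
  finally show ?thesis
    by (simp add: card_permutations[OF refl])
qed

text \<open>For each \<sigma> the sum over \<open>f\<close> factorizes, and permuting the factors
  shows that the product does not depend on \<sigma>.\<close>

lemma sum_sym_tensor:
  fixes V :: "complex ^ 'n ^ 'n" and x :: "complex ^ 'n"
  shows "(\<Sum>f\<in>UNIV. (\<Sum>\<sigma> | \<sigma> permutes UNIV. \<Prod>i\<in>UNIV. V $ \<sigma> i $ f i) * (\<Prod>i\<in>UNIV. x $ f i))
    = fact CARD('n) * (\<Prod>i\<in>UNIV. (V *v x) $ i)"
proof -
  let ?P = "{\<sigma> :: 'n \<Rightarrow> 'n. \<sigma> permutes UNIV}"
  have "(\<Sum>f\<in>UNIV. (\<Sum>\<sigma>\<in>?P. \<Prod>i\<in>UNIV. V $ \<sigma> i $ f i) * (\<Prod>i\<in>UNIV. x $ f i))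
      = (\<Sum>f\<in>UNIV. \<Sum>\<sigma>\<in>?P. \<Prod>i\<in>UNIV. V $ \<sigma> i $ f i * x $ f i)"
    by (simp add: sum_distrib_right prod.distrib)
  also have "\<dots> = (\<Sum>\<sigma>\<in>?P. \<Sum>f\<in>UNIV. \<Prod>i\<in>UNIV. V $ \<sigma> i $ f i * x $ f i)"
    by (rule sum.swap)
  also have "\<dots> = (\<Sum>\<sigma>\<in>?P. \<Prod>i\<in>UNIV. (V *v x) $ \<sigma> i)"
    by (simp add: matrix_vector_mult_def prod_sum_UNIV)
  also have "\<dots> = (\<Sum>\<sigma>\<in>?P. \<Prod>i\<in>UNIV. (V *v x) $ i)"
  proof (intro sum.cong refl)
    fix \<sigma> assume "\<sigma> \<in> ?P"
    then show "(\<Prod>i\<in>UNIV. (V *v x) $ \<sigma> i) = (\<Prod>i\<in>UNIV. (V *v x) $ i)"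
      by (simp add: prod.permute[of \<sigma> UNIV "\<lambda>i. (V *v x) $ i"] o_def)
  qed
  finally show ?thesis
    by (simp add: card_permutations[OF refl])
qed

lemma norm_vec_power2: "(norm x)\<^sup>2 = (\<Sum>i\<in>UNIV. (norm (x $ i))\<^sup>2)"
  by (simp add: norm_vec_def L2_set_def sum_nonneg)

lemma r_obj_eq: "r_obj V x = (cmod (\<Prod>i\<in>UNIV. (V *v x) $ i))\<^sup>2"
  by (simp add: r_obj_def cdot_rowvec prod_norm [symmetric] prod_power_distrib)

text \<open>
  Both sides are norms of symmetric tensors: \<open>\<Prod>\<^sub>i \<langle>v\<^sub>i, x\<rangle>\<close> is the inner product of the
  symmetrized \<open>v\<^sub>1 \<otimes> \<dots> \<otimes> v\<^sub>n\<close> with \<open>x \<otimes> \<dots> \<otimes> x\<close>, so this is Cauchy-Schwarz.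
\<close>

lemma permanent_ge_r_obj:
  fixes V :: "complex ^ 'n ^ 'n"
  shows "of_real (fact CARD('n) * r_obj V x) \<le> permanent (V ** mat_dagger V) * of_real (norm x ^ (2 * CARD('n)))"
proof -
  define S where "S = (\<lambda>f :: 'n \<Rightarrow> 'n. \<Sum>\<sigma> | \<sigma> permutes UNIV. \<Prod>i\<in>UNIV. V $ \<sigma> i $ f i)"
  define T where "T = (\<lambda>f :: 'n \<Rightarrow> 'n. \<Prod>i\<in>UNIV. x $ f i)"
  define N where "N = (\<Sum>f\<in>UNIV. (cmod (S f))\<^sup>2)"
  have N: "permanent (V ** mat_dagger V) = of_real (N / fact CARD('n))"
    using gram_permanent[of V] by (simp add: N_def S_def field_simps)
  have T: "(\<Sum>f\<in>UNIV. (cmod (T f))\<^sup>2) = norm x ^ (2 * CARD('n))"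
    using prod_sum_UNIV[of "\<lambda>_ :: 'n. \<lambda>k. (cmod (x $ k))\<^sup>2"]
    by (simp add: T_def prod_norm [symmetric] prod_power_distrib power_mult norm_vec_power2)
  have "fact CARD('n) ^ 2 * r_obj V x = (cmod (\<Sum>f\<in>UNIV. S f * T f))\<^sup>2"
    unfolding S_def T_def sum_sym_tensor by (simp add: r_obj_eq norm_mult power_mult_distrib)
  also have "\<dots> \<le> (\<Sum>f\<in>UNIV. cmod (S f) * cmod (T f))\<^sup>2"
    by (intro power_mono order.trans[OF norm_sum]) (simp_all add: norm_mult)
  also have "\<dots> \<le> N * norm x ^ (2 * CARD('n))"
    unfolding N_def T [symmetric] by (rule Cauchy_Schwarz_ineq_sum)
  finally have "fact CARD('n) * r_obj V x \<le> N / fact CARD('n) * norm x ^ (2 * CARD('n))"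
    by (simp add: field_simps power2_eq_square)
  then show ?thesis
    unfolding N of_real_mult [symmetric] less_eq_complex_def Re_complex_of_real Im_complex_of_real by simp
qed

text \<open>The exponential series at n dominates its single term of index n.\<close>

lemma exp_fact_ge_power: "real n ^ n \<le> exp (real n) * fact n"
proof -
  have "real n ^ n / fact n \<le> (\<Sum>k. real n ^ k / fact k)"
    using sum_le_suminf[OF summable_exp, of "{n}" "real n"]
    by (simp add: field_simps scaleR_conv_of_real)
  then show ?thesis
    by (simp add: exp_def scaleR_conv_of_real field_simps)
qed

text \<open>At a maximizer the unnormalized squared norm is n, so Cauchy-Schwarz carries the factor
  n^n, and n! / n^n >= e^(-n).\<close>

lemma permanent_ge_r_max:
  fixes V :: "complex ^ 'n ^ 'n"
  shows "of_real (exp (- real CARD('n)) * r_max V) \<le> permanent (V ** mat_dagger V)"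
proof -
  obtain x where x: "nnorm x = 1" "r_obj V x = r_max V"
    using r_max_attained[of V] by blast
  define m where "m = CARD('n)"
  have r0: "0 \<le> r_max V"
    by (simp add: x(2) [symmetric] r_obj_def prod_nonneg)
  have "m > 0" by (simp add: m_def)
  have "norm x = sqrt m"
    using x(1) by (simp add: nnorm_eq m_def field_simps)
  then have nx: "norm x ^ (2 * m) = real m ^ m"
    by (simp add: power_mult)
  \<comment> \<open>The Gram formula shows that the permanent is real, so the comparison can be made
    in the reals.\<close>
  obtain p where p: "permanent (V ** mat_dagger V) = of_real p"
  proof
    show "permanent (V ** mat_dagger V) = of_real ((\<Sum>f\<in>UNIV. (cmod (\<Sum>\<sigma> | \<sigma> permutes UNIV.
        \<Prod>i\<in>UNIV. V $ \<sigma> i $ f i))\<^sup>2) / fact CARD('n))"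
      unfolding of_real_divide gram_permanent by simp
  qed
  have "fact m * r_max V \<le> p * real m ^ m"
    using permanent_ge_r_obj[of V x] unfolding p m_def [symmetric] nx x
    by (simp add: less_eq_complex_def)
  then have "fact m * r_max V / real m ^ m \<le> p"
    using \<open>m > 0\<close> by (simp add: field_simps)
  moreover have "exp (- real m) * r_max V \<le> fact m * r_max V / real m ^ m"
  proof -
    have "real m ^ m * r_max V \<le> exp (real m) * fact m * r_max V"
      by (rule mult_right_mono[OF exp_fact_ge_power r0])
    then have "r_max V \<le> exp (real m) * (fact m * r_max V / real m ^ m)"
      using \<open>m > 0\<close> by (simp add: pos_le_divide_eq mult_ac)
    then show ?thesis
      by (simp add: exp_minus inverse_eq_divide pos_divide_le_eq mult_ac)
  qed
  ultimately show ?thesis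
    unfolding p less_eq_complex_def Re_complex_of_real Im_complex_of_real by (simp add: m_def)
qed

section \<open>Complex Gaussians and the exponential integral\<close>

text \<open>Variance 1/2 makes \<open>Complex p q\<close> with independent \<open>p\<close> and
  \<open>q\<close> a standard complex Gaussian, of mean squared modulus 1.\<close>

definition gauss :: "real measure" where
  "gauss = density lborel (\<lambda>x. ennreal (normal_density 0 (1 / sqrt 2) x))"

lemma prob_space_gauss: "prob_space gauss"
  unfolding gauss_def by (rule prob_space_normal_density) simp

lemma sets_gauss [measurable_cong]: "sets gauss = sets borel"
  by (simp add: gauss_def)

lemma space_gauss [simp]: "space gauss = UNIV"
  by (simp add: gauss_def)

lemma nn_integral_gauss:
  assumes [measurable]: "f \<in> borel_measurable borel" and f: "\<And>x. 0 \<le> f x"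
  shows "(\<integral>\<^sup>+x. ennreal (f x) \<partial>gauss) = (\<integral>\<^sup>+x. ennreal (normal_density 0 (1 / sqrt 2) x * f x) \<partial>lborel)"
  unfolding gauss_def
  by (subst nn_integral_density) (auto simp: ennreal_mult f)

text \<open>Completing the square: density times integrand is a constant times the normal density of
  mean -um/(1+u) and variance 1/(2(1+u)).\<close>

lemma nn_integral_gauss_exp:
  assumes u: "0 \<le> u"
  shows "(\<integral>\<^sup>+x. ennreal (exp (- u * (x + m)\<^sup>2)) \<partial>gauss) = ennreal (exp (- u * m\<^sup>2 / (1 + u)) / sqrt (1 + u))"
proof -
  define c where "c = exp (- u * m\<^sup>2 / (1 + u)) / sqrt (1 + u)"
  have u1: "1 + u > 0" using u by simp
  have nd: "normal_density \<mu> (1 / sqrt (2 * (1 + u))) x = sqrt (1 + u) / sqrt pi * exp (- ((1 + u) * (x - \<mu>)\<^sup>2))" for \<mu> x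
  proof -
    have s: "(1 / sqrt (2 * (1 + u)))\<^sup>2 = 1 / (2 * (1 + u))"
      using u1 by (simp add: power_divide)
    have "- (x - \<mu>)\<^sup>2 / (2 * (1 / (2 * (1 + u)))) = - ((1 + u) * (x - \<mu>)\<^sup>2)"
      using u1 by simp
    moreover have "1 / sqrt (2 * pi * (1 / (2 * (1 + u)))) = sqrt (1 + u) / sqrt pi"
    proof -
      have "2 * pi * (1 / (2 * (1 + u))) = pi / (1 + u)"
        using u1 by (simp add: divide_simps)
      then show ?thesis
        using u1 by (simp add: real_sqrt_divide)
    qed
    ultimately show ?thesis
      unfolding normal_density_def s by simp
  qed
  have eq: "normal_density 0 (1 / sqrt 2) x * exp (- u * (x + m)\<^sup>2)
      = c * normal_density (- u * m / (1 + u)) (1 / sqrt (2 * (1 + u))) x" for x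
  proof -
    have e: "- x\<^sup>2 + (- u * (x + m)\<^sup>2) = - u * m\<^sup>2 / (1 + u) + (- ((1 + u) * (x + u * m / (1 + u))\<^sup>2))"
      using u1 by (simp add: divide_simps power2_eq_square) algebra
    have "normal_density 0 (1 / sqrt 2) x * exp (- u * (x + m)\<^sup>2) = exp (- x\<^sup>2 + (- u * (x + m)\<^sup>2)) / sqrt pi"
      by (simp add: normal_density_def power_divide mult_exp_exp)
    also have "\<dots> = c * normal_density (- u * m / (1 + u)) (1 / sqrt (2 * (1 + u))) x"
      unfolding e exp_add nd using u1 by (simp add: c_def)
    finally show ?thesis .
  qed
  have "(\<integral>\<^sup>+x. ennreal (exp (- u * (x + m)\<^sup>2)) \<partial>gauss)
      = (\<integral>\<^sup>+x. ennreal (c * normal_density (- u * m / (1 + u)) (1 / sqrt (2 * (1 + u))) x) \<partial>lborel)"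
    by (subst nn_integral_gauss) (simp, simp, simp only: eq)
  also have "\<dots> = ennreal c * (\<integral>\<^sup>+x. ennreal (normal_density (- u * m / (1 + u)) (1 / sqrt (2 * (1 + u))) x) \<partial>lborel)"
    using u1 by (subst nn_integral_cmult [symmetric]) (simp, subst ennreal_mult' [symmetric], auto simp: c_def)
  also have "(\<integral>\<^sup>+x. ennreal (normal_density (- u * m / (1 + u)) (1 / sqrt (2 * (1 + u))) x) \<partial>lborel) = 1"
    using u1 by (subst nn_integral_eq_integral) auto
  finally show ?thesis by (simp add: c_def)
qed

lemma nn_integral_gauss_square: "(\<integral>\<^sup>+x. ennreal ((x + m)\<^sup>2) \<partial>gauss) = ennreal (m\<^sup>2 + 1 / 2)"
proof -
  let ?d = "normal_density 0 (1 / sqrt 2)"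
  have i: "integrable lborel (\<lambda>x. ?d x * x ^ k)" for k
    using integrable_normal_moment[of "1 / sqrt 2" 0 k] by simp
  have 2: "(\<integral>x. ?d x * x\<^sup>2 \<partial>lborel) = 1 / 2"
    using integral_normal_moment_even[of "1 / sqrt 2" 0 1] by (simp add: power_divide)
  have 1: "(\<integral>x. ?d x * x \<partial>lborel) = 0"
    using integral_normal_moment_odd[of "1 / sqrt 2" 0 0] by simp
  have e: "?d x * (x + m)\<^sup>2 = ?d x * x\<^sup>2 + (2 * m * (?d x * x) + m\<^sup>2 * ?d x)" for x
    by (simp add: power2_eq_square algebra_simps)
  have int: "integrable lborel (\<lambda>x. ?d x * (x + m)\<^sup>2)"
    unfolding e using i[of 0] i[of 1] i[of 2] by (intro Bochner_Integration.integrable_add integrable_mult_right) auto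
  have "(\<integral>x. ?d x * (x + m)\<^sup>2 \<partial>lborel) = m\<^sup>2 + 1 / 2"
    unfolding e using i[of 0] i[of 1] i[of 2]
    by (subst Bochner_Integration.integral_add Bochner_Integration.integral_add; (auto simp: 1 2)?)+
  then show ?thesis
    using int by (simp add: nn_integral_gauss nn_integral_eq_integral)
qed

text \<open>Factoring out \<open>c\<close> turns its phase into a shift, which separates the two
  real variables. The case \<open>c = 0\<close> is treated apart wherever this is applied.\<close>

lemma cmod_affine_square:
  assumes "c \<noteq> 0"
  shows "(cmod (w + c * Complex p q))\<^sup>2 = (cmod c)\<^sup>2 * ((p + Re (w / c))\<^sup>2 + (q + Im (w / c))\<^sup>2)"
proof -
  have "w + c * Complex p q = c * Complex (p + Re (w / c)) (q + Im (w / c))"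
    using assms by (simp add: Complex_eq distrib_left complex_eq [of "w / c", symmetric] add_ac)
  then show ?thesis
    by (simp only: norm_mult power_mult_distrib cmod_power2 complex.sel)
qed

lemma nn_integral_cgauss_exp:
  assumes l: "0 \<le> l"
  shows "(\<integral>\<^sup>+p. \<integral>\<^sup>+q. ennreal (exp (- l * (cmod (w + c * Complex p q))\<^sup>2)) \<partial>gauss \<partial>gauss)
    = ennreal (exp (- l * (cmod w)\<^sup>2 / (1 + l * (cmod c)\<^sup>2)) / (1 + l * (cmod c)\<^sup>2))"
proof (cases "c = 0")
  case True
  interpret prob_space gauss by (rule prob_space_gauss)
  show ?thesis using True emeasure_space_1 by simp
next
  case False
  define u where "u = l * (cmod c)\<^sup>2"
  define a b where "a = Re (w / c)" and "b = Im (w / c)"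
  have u: "0 \<le> u" using l by (simp add: u_def)
  have w: "(cmod w)\<^sup>2 = (cmod c)\<^sup>2 * (a\<^sup>2 + b\<^sup>2)"
    using cmod_affine_square[OF False, of w 0 0] by (simp add: a_def b_def Complex_eq)
  have "exp (- l * (cmod (w + c * Complex p q))\<^sup>2) = exp (- u * (p + a)\<^sup>2) * exp (- u * (q + b)\<^sup>2)" for p q
    by (simp add: cmod_affine_square[OF False] u_def a_def b_def exp_add [symmetric] algebra_simps)
  then have "(\<integral>\<^sup>+p. \<integral>\<^sup>+q. ennreal (exp (- l * (cmod (w + c * Complex p q))\<^sup>2)) \<partial>gauss \<partial>gauss)
      = (\<integral>\<^sup>+p. \<integral>\<^sup>+q. ennreal (exp (- u * (p + a)\<^sup>2)) * ennreal (exp (- u * (q + b)\<^sup>2)) \<partial>gauss \<partial>gauss)"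
    by (simp add: ennreal_mult')
  also have "\<dots> = (\<integral>\<^sup>+p. ennreal (exp (- u * (p + a)\<^sup>2)) \<partial>gauss) * (\<integral>\<^sup>+q. ennreal (exp (- u * (q + b)\<^sup>2)) \<partial>gauss)"
    by (simp add: nn_integral_cmult nn_integral_multc)
  also have "\<dots> = ennreal (exp (- u * a\<^sup>2 / (1 + u)) / sqrt (1 + u) * (exp (- u * b\<^sup>2 / (1 + u)) / sqrt (1 + u)))"
    unfolding nn_integral_gauss_exp[OF u] using u by (intro ennreal_mult [symmetric]) auto
  also have "exp (- u * a\<^sup>2 / (1 + u)) / sqrt (1 + u) * (exp (- u * b\<^sup>2 / (1 + u)) / sqrt (1 + u))
      = exp (- l * (cmod w)\<^sup>2 / (1 + u)) / (1 + u)"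
    using u by (simp add: w u_def exp_add [symmetric] add_divide_distrib [symmetric] algebra_simps)
  finally show ?thesis by (simp add: u_def)
qed

lemma nn_integral_cgauss_square:
  "(\<integral>\<^sup>+p. \<integral>\<^sup>+q. ennreal ((cmod (w + c * Complex p q))\<^sup>2) \<partial>gauss \<partial>gauss)
    = ennreal ((cmod w)\<^sup>2 + (cmod c)\<^sup>2)"
proof (cases "c = 0")
  case True
  interpret prob_space gauss by (rule prob_space_gauss)
  show ?thesis using True emeasure_space_1 by simp
next
  case False
  interpret prob_space gauss by (rule prob_space_gauss)
  define a b where "a = Re (w / c)" and "b = Im (w / c)"
  have w: "(cmod w)\<^sup>2 = (cmod c)\<^sup>2 * (a\<^sup>2 + b\<^sup>2)"
    using cmod_affine_square[OF False, of w 0 0] by (simp add: a_def b_def Complex_eq)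
  have "(\<integral>\<^sup>+p. \<integral>\<^sup>+q. ennreal ((cmod (w + c * Complex p q))\<^sup>2) \<partial>gauss \<partial>gauss)
      = (\<integral>\<^sup>+p. \<integral>\<^sup>+q. ennreal ((cmod c)\<^sup>2) * (ennreal ((p + a)\<^sup>2) + ennreal ((q + b)\<^sup>2)) \<partial>gauss \<partial>gauss)"
    by (simp add: cmod_affine_square[OF False] a_def b_def ennreal_mult')
  also have "\<dots> = ennreal ((cmod c)\<^sup>2) * (ennreal (a\<^sup>2 + 1 / 2) + ennreal (b\<^sup>2 + 1 / 2))"
    using emeasure_space_1 by (simp add: nn_integral_cmult nn_integral_add nn_integral_gauss_square)
  also have "\<dots> = ennreal ((cmod c)\<^sup>2 * ((a\<^sup>2 + 1 / 2) + (b\<^sup>2 + 1 / 2)))"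
    by (simp add: ennreal_mult' flip: ennreal_plus)
  finally show ?thesis
    by (simp add: w algebra_simps)
qed

lemma borel_measurable_Complex [measurable (raw)]:
  assumes "f \<in> borel_measurable M" "g \<in> borel_measurable M"
  shows "(\<lambda>x. Complex (f x) (g x)) \<in> borel_measurable M"
  using assms unfolding Complex_eq by measurable

text \<open>First-moment principle: were \<open>f\<close> above a finite \<open>c\<close>
  everywhere, cancelling \<open>c\<close> would give the positive function f - c integral 0.\<close>

lemma (in prob_space) nn_integral_le_imp_ex:
  assumes [measurable]: "f \<in> borel_measurable M" and le: "(\<integral>\<^sup>+x. f x \<partial>M) \<le> c"
  shows "\<exists>x\<in>space M. f x \<le> c"
proof (cases c)
  case top
  then show ?thesis using not_empty by auto
next
  case c: (real r)
  show ?thesis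
  proof (rule ccontr)
    assume "\<not> ?thesis"
    then have gt: "c < f x" if "x \<in> space M" for x
      using that by (auto simp: not_le)
    have "c + (\<integral>\<^sup>+x. (f x - c) \<partial>M) = (\<integral>\<^sup>+x. c + (f x - c) \<partial>M)"
      by (subst nn_integral_add) (auto simp: emeasure_space_1)
    also have "\<dots> = (\<integral>\<^sup>+x. f x \<partial>M)"
      using gt by (intro nn_integral_cong) (auto simp: less_imp_le)
    finally have "c + (\<integral>\<^sup>+x. (f x - c) \<partial>M) \<le> c + 0"
      using le by simp
    then have "(\<integral>\<^sup>+x. (f x - c) \<partial>M) = 0"
      by (simp add: c ennreal_add_left_cancel_le)
    then have "AE x in M. f x - c = 0"
      by (simp add: nn_integral_0_iff_AE)
    with AE_space have "AE x in M. False"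
      by eventually_elim (use gt in \<open>force simp: diff_eq_0_iff_ennreal\<close>)
    then show False by simp
  qed
qed

text \<open>
  \<open>expint d 0 a\<close> is the exponential integral \<open>E\<^sub>1 (d a)\<close>, approximately \<open>- \<gamma> - ln d - ln a\<close>. The family is
  closed under Gaussian averaging of \<open>a = |w|\<^sup>2\<close>, the variance being added to \<open>s\<close>. Cutting off the
  divergent integral at \<open>d > 0\<close> replaces \<open>- ln\<close> by a nonnegative function, so no integrability of the
  logarithm is needed.
\<close>

definition expint :: "real \<Rightarrow> real \<Rightarrow> real \<Rightarrow> ennreal" where
  "expint d s a = (\<integral>\<^sup>+l. ennreal (exp (- l * a / (1 + l * s)) / (l * (1 + l * s))) * indicator {d..} l \<partial>lborel)"

lemma expint_measurable [measurable]: "expint d s \<in> borel_measurable borel"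
  unfolding expint_def by measurable

text \<open>By Tonelli the integral over \<open>l\<close> moves outside. The Gaussian Laplace
  transform is then applied at the rate l/(1+ls), and such rates compose by adding
  variances.\<close>

lemma expint_cgauss:
  assumes d: "0 < d" and s: "0 \<le> s"
  shows "(\<integral>\<^sup>+p. \<integral>\<^sup>+q. expint d s ((cmod (w + c * Complex p q))\<^sup>2) \<partial>gauss \<partial>gauss)
    = expint d (s + (cmod c)\<^sup>2) ((cmod w)\<^sup>2)"
proof -
  interpret prob_space gauss by (rule prob_space_gauss)
  interpret P: pair_sigma_finite gauss lborel ..
  let ?f = "\<lambda>p q l. ennreal (exp (- (l / (1 + l * s)) * (cmod (w + c * Complex p q))\<^sup>2)) * (if d \<le> l then ennreal (1 / (l * (1 + l * s))) else 0)"
  have "(\<integral>\<^sup>+p. \<integral>\<^sup>+q. expint d s ((cmod (w + c * Complex p q))\<^sup>2) \<partial>gauss \<partial>gauss)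
      = (\<integral>\<^sup>+p. \<integral>\<^sup>+q. \<integral>\<^sup>+l. ?f p q l \<partial>lborel \<partial>gauss \<partial>gauss)"
    unfolding expint_def using d s
    by (intro nn_integral_cong) (auto simp: indicator_def ennreal_mult' [symmetric])
  also have "\<dots> = (\<integral>\<^sup>+p. \<integral>\<^sup>+l. \<integral>\<^sup>+q. ?f p q l \<partial>gauss \<partial>lborel \<partial>gauss)"
    by (intro nn_integral_cong P.Fubini' [symmetric]) measurable
  also have "\<dots> = (\<integral>\<^sup>+l. \<integral>\<^sup>+p. \<integral>\<^sup>+q. ?f p q l \<partial>gauss \<partial>gauss \<partial>lborel)"
    by (intro P.Fubini' [symmetric]) measurable
  also have "\<dots> = (\<integral>\<^sup>+l. ennreal (exp (- l * (cmod w)\<^sup>2 / (1 + l * (s + (cmod c)\<^sup>2))) / (l * (1 + l * (s + (cmod c)\<^sup>2)))) * indicator {d..} l \<partial>lborel)"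
  proof (intro nn_integral_cong)
    fix l :: real
    show "(\<integral>\<^sup>+p. \<integral>\<^sup>+q. ?f p q l \<partial>gauss \<partial>gauss)
      = ennreal (exp (- l * (cmod w)\<^sup>2 / (1 + l * (s + (cmod c)\<^sup>2))) / (l * (1 + l * (s + (cmod c)\<^sup>2)))) * indicator {d..} l"
    proof (cases "l \<ge> d")
      case True
      define e where "e = 1 + l * s"
      have l: "0 < l" using True d by simp
      have e: "0 < e" using l s by (simp add: e_def add_pos_nonneg)
      have e2: "1 + l / e * (cmod c)\<^sup>2 = (1 + l * (s + (cmod c)\<^sup>2)) / e"
        using e by (simp add: field_simps e_def)
      have e3: "0 < 1 + l * (s + (cmod c)\<^sup>2)"
        using l s by (intro add_pos_nonneg) auto
      have "(\<integral>\<^sup>+p. \<integral>\<^sup>+q. ?f p q l \<partial>gauss \<partial>gauss)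
          = (\<integral>\<^sup>+p. \<integral>\<^sup>+q. ennreal (exp (- (l / e) * (cmod (w + c * Complex p q))\<^sup>2)) \<partial>gauss \<partial>gauss) * ennreal (1 / (l * e))"
        using True unfolding e_def [symmetric]
        by (simp add: nn_integral_multc)
      also have "\<dots> = ennreal (exp (- (l / e) * (cmod w)\<^sup>2 / (1 + (l / e) * (cmod c)\<^sup>2)) / (1 + (l / e) * (cmod c)\<^sup>2)) * ennreal (1 / (l * e))"
        using l e by (subst nn_integral_cgauss_exp) auto
      also have "\<dots> = ennreal (exp (- l * (cmod w)\<^sup>2 / (1 + l * (s + (cmod c)\<^sup>2))) / (l * (1 + l * (s + (cmod c)\<^sup>2))))"
        unfolding e2 using l e e3 by (simp add: ennreal_mult' [symmetric] mult_ac)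
      finally show ?thesis using True by simp
    qed simp
  qed
  finally show ?thesis by (simp add: expint_def)
qed

section \<open>Bounds for the exponential integral\<close>

lemma expint_antimono:
  assumes "0 < d" "0 \<le> s" "a \<le> b"
  shows "expint d s b \<le> expint d s a"
  unfolding expint_def
proof (intro nn_integral_mono)
  fix l :: real
  show "ennreal (exp (- l * b / (1 + l * s)) / (l * (1 + l * s))) * indicator {d..} l
      \<le> ennreal (exp (- l * a / (1 + l * s)) / (l * (1 + l * s))) * indicator {d..} l"
    using assms by (cases "d \<le> l") (auto intro!: ennreal_leI divide_right_mono mult_left_mono)
qed

text \<open>On [d, m/a] the exponential exp(-la) is at least (1 - la/m)^m, for which the integral is
  elementary and produces a harmonic number.\<close>

lemma expint_0_ge_harm:
  assumes d: "0 < d" and a: "0 < a" and m: "d * a < real m"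
  shows "ennreal (ln (real m) - harm m - ln (d * a)) \<le> expint d 0 a"
proof -
  have m0: "0 < real m" using m d a by (smt (verit) mult_pos_pos)
  define c where "c = a / real m"
  have c: "0 < c" using a m0 by (simp add: c_def)
  \<comment> \<open>Antiderivative from (1-lc)^m / l = 1/l - c * (sum of (1-lc)^k over k < m). Its
    sum vanishes at l = 1/c and is at most \<open>harm m\<close> at \<open>d\<close>.\<close>
  define F where "F = (\<lambda>l. ln l + (\<Sum>k=1..m. (1 - l * c) ^ k / real k))"
  have F': "DERIV F l :> (1 - l * c) ^ m / l" if "0 < l" for l
  proof -
    have "DERIV F l :> 1 / l + (\<Sum>k=1..m. real k * (1 - l * c) ^ (k - 1) * (- c) / real k)"
      unfolding F_def using that
      by (auto intro!: derivative_eq_intros sum.cong simp: field_simps)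
    also have "(\<Sum>k=1..m. real k * (1 - l * c) ^ (k - 1) * (- c) / real k) = - c * (\<Sum>k<m. (1 - l * c) ^ k)"
      unfolding sum_distrib_left
      by (intro sum.reindex_bij_witness[of _ Suc "\<lambda>k. k - 1"]) auto
    also have "1 / l + \<dots> = (1 - l * c) ^ m / l"
      using that c by (simp add: sum_gp_strict field_simps)
    finally show ?thesis .
  qed
  have "d \<le> 1 / c" using m a by (simp add: c_def field_simps)
  have "ln (real m) - harm m - ln (d * a) \<le> F (1 / c) - F d"
  proof -
    have "(\<Sum>k=1..m. (1 - d * c) ^ k / real k) \<le> (\<Sum>k=1..m. inverse (real k))"
      using d c \<open>d \<le> 1 / c\<close>
      by (intro sum_mono) (auto simp: field_simps intro!: power_le_one)
    moreover have "(\<Sum>k=1..m. (1 - 1 / c * c) ^ k / real k) = 0"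
      using c by (intro sum.neutral) auto
    ultimately have "F (1 / c) - F d \<ge> ln (1 / c) - ln d - harm m"
      by (simp add: F_def harm_def)
    moreover have "ln (1 / c) = ln (real m) - ln a"
      using a m0 by (simp add: c_def ln_div)
    ultimately show ?thesis
      using a d by (simp add: ln_mult)
  qed
  then have "ennreal (ln (real m) - harm m - ln (d * a)) \<le> ennreal (F (1 / c) - F d)"
    by (rule ennreal_leI)
  also have "\<dots> = (\<integral>\<^sup>+l. ennreal ((1 - l * c) ^ m / l) * indicator {d..1 / c} l \<partial>lborel)"
    using d c \<open>d \<le> 1 / c\<close>
    by (intro nn_integral_FTC_Icc [symmetric] F')
       (auto intro!: divide_nonneg_nonneg zero_le_power simp: field_simps)
  also have "\<dots> \<le> expint d 0 a"
    unfolding expint_def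
  proof (intro nn_integral_mono)
    fix l :: real
    show "ennreal ((1 - l * c) ^ m / l) * indicator {d..1 / c} l
        \<le> ennreal (exp (- l * a / (1 + l * 0)) / (l * (1 + l * 0))) * indicator {d..} l"
    proof (cases "l \<in> {d..1 / c}")
      case True
      then have l: "0 < l" "l * c \<le> 1" using d c by (auto simp: field_simps)
      have "(1 - l * c) ^ m \<le> exp (- (l * c)) ^ m"
        using l exp_ge_add_one_self[of "- (l * c)"] by (intro power_mono) auto
      also have "\<dots> = exp (- l * a)"
        using m0 by (simp add: exp_of_nat_mult [symmetric] c_def)
      finally show ?thesis
        using True l by (auto intro!: ennreal_leI divide_right_mono)
    qed simp
  qed
  finally show ?thesis .
qed

text \<open>The limit of the harmonic bounds, since \<open>harm m - ln m\<close> tends to Euler's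
  constant.\<close>

lemma expint_0_ge:
  assumes d: "0 < d" and a: "0 < a"
  shows "ennreal (- euler_mascheroni - ln (d * a)) \<le> expint d 0 a"
proof (rule LIMSEQ_le_const2)
  show "(\<lambda>m. ennreal (- (harm m - ln (real m)) - ln (d * a))) \<longlonglongrightarrow> ennreal (- euler_mascheroni - ln (d * a))"
    by (intro tendsto_ennrealI tendsto_intros euler_mascheroni_LIMSEQ)
  have "eventually (\<lambda>m. d * a < real m) sequentially"
    by real_asymp
  then show "\<exists>N. \<forall>m\<ge>N. ennreal (- (harm m - ln (real m)) - ln (d * a)) \<le> expint d 0 a"
    unfolding eventually_sequentially using expint_0_ge_harm[OF d a] by (auto simp: algebra_simps)
qed

text \<open>The logarithmic lower bound blows up as \<open>a\<close> tends to 0. Hence a finite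
  potential forces all inner products to be nonzero.\<close>

lemma expint_0_0:
  assumes d: "0 < d"
  shows "expint d 0 0 = \<infinity>"
proof -
  have "ennreal (real k) \<le> expint d 0 0" for k
  proof -
    \<comment> \<open>Solves -\<gamma> - ln (d a) = k for \<open>a\<close>.\<close>
    define a where "a = exp (- euler_mascheroni - real k) / d"
    have "0 < a" using d by (simp add: a_def)
    have "ennreal (real k) = ennreal (- euler_mascheroni - ln (d * a))"
      using d by (simp add: a_def)
    also have "\<dots> \<le> expint d 0 a"
      by (rule expint_0_ge[OF d \<open>0 < a\<close>])
    also have "\<dots> \<le> expint d 0 0"
      using d \<open>0 < a\<close> by (intro expint_antimono) auto
    finally show ?thesis .
  qed
  then show ?thesis
    by (metis ennreal_of_nat_eq_real_of_nat ennreal_Ex_less_of_nat infinity_ennreal_def leD top.not_eq_extremum)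
qed

text \<open>The exponential is replaced by its quadratic Taylor majorant in y = a l/(1+l); the
  integrand \<open>f\<close> so obtained has the antiderivative \<open>F\<close>.\<close>

lemma expint_1_le:
  assumes d: "0 < d" and a: "0 \<le> a"
  shows "expint d 1 a \<le> ennreal (ln (1 + d) - ln d - a / (1 + d) + a\<^sup>2 / 4)"
proof -
  define F where "F = (\<lambda>l. ln (l / (1 + l)) + a / (1 + l) + a\<^sup>2 / 4 * (l / (1 + l))\<^sup>2)"
  define f where "f = (\<lambda>l. (1 - a * (l / (1 + l)) + (a * (l / (1 + l)))\<^sup>2 / 2) / (l * (1 + l)))"
  have q: "exp (- y) \<le> 1 - y + y\<^sup>2 / 2" if "0 \<le> y" for y :: real
  proof -
    \<comment> \<open>The subtracted bracket is the value at 0, namely 0, written out to fit the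
      mean value theorem.\<close>
    have "0 \<le> (1 - y + y\<^sup>2 / 2 - exp (- y)) - (1 - 0 + 0\<^sup>2 / 2 - exp (- 0))"
    proof (cases "y = 0")
      case False
      have "\<exists>z. 0 < z \<and> z < y \<and> (1 - y + y\<^sup>2 / 2 - exp (- y)) - (1 - 0 + 0\<^sup>2 / 2 - exp (- 0)) = (y - 0) * (- 1 + z + exp (- z))"
        using False that
        by (intro MVT2) (auto intro!: derivative_eq_intros)
      then obtain z where "0 < z" "(1 - y + y\<^sup>2 / 2 - exp (- y)) - (1 - 0 + 0\<^sup>2 / 2 - exp (- 0)) = (y - 0) * (- 1 + z + exp (- z))"
        by blast
      moreover have "0 \<le> - 1 + z + exp (- z)"
        using exp_ge_add_one_self[of "- z"] by linarith
      ultimately show ?thesis using that by simp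
    qed simp
    then show ?thesis by simp
  qed
  have f0: "0 \<le> f l" if "d \<le> l" for l
  proof -
    have "0 \<le> l / (1 + l)" using that d by simp
    then have "0 \<le> 1 - a * (l / (1 + l)) + (a * (l / (1 + l)))\<^sup>2 / 2"
      using q[of "a * (l / (1 + l))"] a by (smt (verit) exp_ge_zero mult_nonneg_nonneg)
    then show ?thesis using that d by (simp add: f_def)
  qed
  have F': "DERIV F l :> f l" if "d \<le> l" for l
  proof -
    have l: "0 < l" using that d by simp
    then have "1 + l \<noteq> 0" by linarith
    with l show ?thesis
      unfolding F_def f_def
      apply (auto intro!: derivative_eq_intros)
      apply (simp add: divide_simps)
      apply (simp add: power2_eq_square algebra_simps)
      done
  qed
  have "(F \<longlongrightarrow> a\<^sup>2 / 4) at_top"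
    unfolding F_def by real_asymp
  then have "(\<integral>\<^sup>+l. ennreal (f l) * indicator {d..} l \<partial>lborel) = ennreal (a\<^sup>2 / 4 - F d)"
    by (intro nn_integral_FTC_atLeast F' f0) (auto simp: f_def)
  moreover have "expint d 1 a \<le> (\<integral>\<^sup>+l. ennreal (f l) * indicator {d..} l \<partial>lborel)"
    unfolding expint_def
  proof (intro nn_integral_mono)
    fix l :: real
    show "ennreal (exp (- l * a / (1 + l * 1)) / (l * (1 + l * 1))) * indicator {d..} l \<le> ennreal (f l) * indicator {d..} l"
    proof (cases "d \<le> l")
      case True
      then have "0 \<le> a * (l / (1 + l))" "0 < l" using d a by auto
      then show ?thesis
        using q[of "a * (l / (1 + l))"] True
        by (auto simp: f_def intro!: ennreal_leI divide_right_mono) (simp add: mult.commute)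
    qed simp
  qed
  \<comment> \<open>This drops the nonnegative last term of \<open>F d\<close>.\<close>
  moreover have "a\<^sup>2 / 4 - F d \<le> ln (1 + d) - ln d - a / (1 + d) + a\<^sup>2 / 4"
    using d by (simp add: F_def ln_div)
  ultimately show ?thesis
    by (metis ennreal_leI order.trans)
qed

text \<open>
  The method of conditional expectations: each complex Gaussian coefficient of \<open>b\<^sub>k\<close> is fixed in
  turn so as not to increase the conditional expectation of the potential, which \<open>expint_cgauss\<close>
  gives in closed form.
\<close>

lemma ex_expint_le:
  fixes v :: "'i \<Rightarrow> complex ^ 'n" and b :: "'k \<Rightarrow> complex ^ 'n"
  assumes S: "finite S" and I: "finite I" and d: "0 < d" and c: "0 \<le> c" and s: "\<And>i. 0 \<le> s i"
  shows "\<exists>y. (\<Sum>i\<in>I. expint d (s i) ((cmod (cdot (v i) y))\<^sup>2)) + ennreal (c * (norm y)\<^sup>2)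
    \<le> (\<Sum>i\<in>I. expint d (s i + (\<Sum>k\<in>S. (cmod (cdot (v i) (b k)))\<^sup>2)) ((cmod (cdot (v i) x))\<^sup>2))
      + ennreal (c * ((norm x)\<^sup>2 + (\<Sum>k\<in>S. (norm (b k))\<^sup>2)))"
  using S
proof (induction S arbitrary: x)
  case empty
  show ?case by (intro exI[of _ x]) simp
next
  case (insert k S)
  interpret prob_space gauss by (rule prob_space_gauss)
  define s' where "s' = (\<lambda>i. s i + (\<Sum>k\<in>S. (cmod (cdot (v i) (b k)))\<^sup>2))"
  define C where "C = (\<Sum>k\<in>S. (norm (b k))\<^sup>2)"
  have s': "0 \<le> s' i" for i using s by (simp add: s'_def sum_nonneg)
  have C: "0 \<le> C" by (simp add: C_def sum_nonneg)
  \<comment> \<open>\<open>G p q\<close> is the conditional expectation once the coefficient of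
    \<open>b k\<close> is fixed to \<open>Complex p q\<close>; \<open>s'\<close> holds the variance
    of the coefficients still random.\<close>
  define G where "G = (\<lambda>p q. (\<Sum>i\<in>I. expint d (s' i) ((cmod (cdot (v i) x + cdot (v i) (b k) * Complex p q))\<^sup>2))
    + (ennreal c * (\<Sum>j\<in>UNIV. ennreal ((cmod (x $ j + b k $ j * Complex p q))\<^sup>2)) + ennreal (c * C)))"
  define R where "R = (\<Sum>i\<in>I. expint d (s' i + (cmod (cdot (v i) (b k)))\<^sup>2) ((cmod (cdot (v i) x))\<^sup>2))
      + ennreal (c * ((norm x)\<^sup>2 + (norm (b k))\<^sup>2 + C))"
  have "(\<integral>\<^sup>+p. \<integral>\<^sup>+q. G p q \<partial>gauss \<partial>gauss)
      = (\<Sum>i\<in>I. \<integral>\<^sup>+p. \<integral>\<^sup>+q. expint d (s' i) ((cmod (cdot (v i) x + cdot (v i) (b k) * Complex p q))\<^sup>2) \<partial>gauss \<partial>gauss)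
       + (ennreal c * (\<Sum>j\<in>UNIV. \<integral>\<^sup>+p. \<integral>\<^sup>+q. ennreal ((cmod (x $ j + b k $ j * Complex p q))\<^sup>2) \<partial>gauss \<partial>gauss) + ennreal (c * C))"
    unfolding G_def by (simp add: nn_integral_add nn_integral_sum nn_integral_cmult emeasure_space_1[unfolded space_gauss]
      del: sum_ennreal)
  also have "\<dots> = R"
  proof -
    have "(\<Sum>j\<in>UNIV. ennreal ((cmod (x $ j))\<^sup>2 + (cmod (b k $ j))\<^sup>2)) = ennreal ((norm x)\<^sup>2 + (norm (b k))\<^sup>2)"
      by (simp add: sum_ennreal sum.distrib norm_vec_power2 del: ennreal_plus)
    then show ?thesis
      unfolding R_def expint_cgauss[OF d s'] nn_integral_cgauss_square using c C
      by (simp add: distrib_left[of c] ennreal_mult' [symmetric] ennreal_plus [symmetric] del: ennreal_plus)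
  qed
  finally have le: "(\<integral>\<^sup>+p. \<integral>\<^sup>+q. G p q \<partial>gauss \<partial>gauss) \<le> R"
    by simp
  have [measurable]: "case_prod G \<in> borel_measurable (borel \<Otimes>\<^sub>M borel)"
    unfolding G_def case_prod_beta by measurable
  have "(\<lambda>p. \<integral>\<^sup>+q. G p q \<partial>gauss) \<in> borel_measurable gauss"
    by measurable
  \<comment> \<open>Real and imaginary part of the coefficient are fixed one after the
    other.\<close>
  from nn_integral_le_imp_ex[OF this le] obtain p where "(\<integral>\<^sup>+q. G p q \<partial>gauss) \<le> R"
    by blast
  moreover have "G p \<in> borel_measurable gauss"
    by measurable
  ultimately obtain q where q: "G p q \<le> R"
    using nn_integral_le_imp_ex by blast
  define y where "y = x + Complex p q *s b k"
  have cdot_y: "cdot (v i) y = cdot (v i) x + cdot (v i) (b k) * Complex p q" for i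
    by (simp add: y_def cdot_add cdot_scale)
  have norm_y: "(norm y)\<^sup>2 = (\<Sum>j\<in>UNIV. (cmod (x $ j + b k $ j * Complex p q))\<^sup>2)"
    by (simp add: norm_vec_power2 y_def mult.commute)
  obtain z where "(\<Sum>i\<in>I. expint d (s i) ((cmod (cdot (v i) z))\<^sup>2)) + ennreal (c * (norm z)\<^sup>2)
    \<le> (\<Sum>i\<in>I. expint d (s' i) ((cmod (cdot (v i) y))\<^sup>2)) + ennreal (c * ((norm y)\<^sup>2 + C))"
    using insert.IH[of y] unfolding s'_def C_def by blast
  also have "\<dots> = G p q"
    unfolding G_def cdot_y norm_y using c C
    by (simp add: sum_nonneg distrib_left[of c] ennreal_mult' ennreal_plus)
  also note q
  finally show ?case
    using insert.hyps by (auto simp: R_def s'_def C_def add_ac)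
qed

section \<open>Homogeneity of the product objective\<close>

lemma r_obj_scale: "r_obj V (of_real a *s x) = (a\<^sup>2) ^ CARD('n) * r_obj (V :: complex ^ 'n ^ 'n) x"
  by (simp add: r_obj_def cdot_scale norm_mult power_mult_distrib prod.distrib)

lemma r_obj_le_r_max:
  fixes V :: "complex ^ 'n ^ 'n"
  assumes "x \<noteq> 0"
  shows "r_obj V x \<le> r_max V * ((norm x)\<^sup>2 / real CARD('n)) ^ CARD('n)"
proof -
  define a where "a = sqrt (real CARD('n)) / norm x"
  have "norm (of_real a *s x) = \<bar>a\<bar> * norm x"
    by (simp add: norm_vec_def L2_set_def norm_mult power_mult_distrib real_sqrt_mult flip: sum_distrib_left)
  then have "nnorm (of_real a *s x) = 1"
    using assms by (simp add: nnorm_eq a_def)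
  then have "r_obj V (of_real a *s x) \<le> r_max V"
    using r_max_attained[of V] by metis
  then have "(a\<^sup>2) ^ CARD('n) * r_obj V x \<le> r_max V"
    by (simp add: r_obj_scale)
  moreover have "(a\<^sup>2) ^ CARD('n) * ((norm x)\<^sup>2 / real CARD('n)) ^ CARD('n) = 1"
    using assms by (simp add: a_def power_divide mult.commute flip: power_mult_distrib)
  ultimately show ?thesis
    using mult_right_mono[of "(a\<^sup>2) ^ CARD('n) * r_obj V x" "r_max V" "((norm x)\<^sup>2 / real CARD('n)) ^ CARD('n)"]
    by (simp add: mult.assoc mult.left_commute[of _ "r_obj V x"])
qed

section \<open>Positive semidefinite matrices\<close>

lemma psd_hermitian:
  assumes "psd X" shows "X $ i $ j = cnj (X $ j $ i)"
proof -
  have "X $ i $ j = mat_dagger X $ i $ j"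
    using assms by (simp add: psd_def)
  then show ?thesis by (simp add: mat_dagger_def)
qed

text \<open>Positivity of the form at x + z e_m, expanded in \<open>z\<close>.\<close>

lemma psd_shift:
  fixes X :: "complex ^ 'n ^ 'n" and m :: 'n
  assumes X: "psd X"
  defines "y \<equiv> \<lambda>x. \<Sum>i\<in>UNIV. cnj (x $ i) * X $ i $ m"
  shows "0 \<le> Re (cdot x (X *v x)) + 2 * Re (z * y x) + (cmod z)\<^sup>2 * Re (X $ m $ m)"
proof -
  define w where "w = x + z *s axis m 1"
  note herm = psd_hermitian[OF X]
  have "(X *v axis m 1) $ i = X $ i $ m" for i
    by (simp add: matrix_vector_mult_def axis_def if_distrib cong: if_cong)
  then have Xw: "(X *v w) $ i = (X *v x) $ i + z * X $ i $ m" for i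
    by (simp add: w_def matrix_vector_right_distrib vector_scalar_commute)
  have "(X *v x) $ m = cnj (y x)"
    by (simp add: y_def matrix_vector_mult_def herm [symmetric] mult.commute)
  moreover have "cdot w u = cdot x u + cnj z * u $ m" for u
  proof -
    have "(\<Sum>i\<in>UNIV. cnj (z * (if i = m then 1 else 0)) * u $ i) = (\<Sum>i\<in>UNIV. if i = m then cnj z * u $ i else 0)"
      by (intro sum.cong) auto
    then show ?thesis
      by (simp add: w_def cdot_def axis_def distrib_right sum.distrib)
  qed
  moreover have "cdot x (X *v w) = cdot x (X *v x) + z * y x"
    by (simp add: cdot_def Xw y_def distrib_left sum.distrib sum_distrib_left mult_ac)
  ultimately have "cdot w (X *v w) = cdot x (X *v x) + z * y x + cnj z * (cnj (y x) + z * X $ m $ m)"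
    by (simp add: Xw)
  moreover have "0 \<le> Re (cdot w (X *v w))"
    using X by (simp add: psd_def less_eq_complex_def)
  moreover have "Re (cnj z * (z * X $ m $ m)) = (cmod z)\<^sup>2 * Re (X $ m $ m)"
    unfolding cmod_power2 by (simp add: power2_eq_square algebra_simps)
  moreover have "Re (cnj z * cnj (y x)) = Re (z * y x)"
    by simp
  ultimately show ?thesis
    by (simp only: distrib_left plus_complex.sel)
qed

lemma psd_diag:
  assumes "psd X" shows "0 \<le> Re (X $ m $ m)" "Im (X $ m $ m) = 0"
proof -
  show "0 \<le> Re (X $ m $ m)"
    using psd_shift[OF assms, of 0 1 m] by (simp add: cdot_def)
  show "Im (X $ m $ m) = 0"
    using psd_hermitian[OF assms, of m m] by (simp add: complex_eq_iff)
qed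

text \<open>Shifting by z = -u cnj y with real \<open>u\<close> gives a nonnegative quadratic in
  \<open>u\<close>, evaluated at its minimizer 1/r. For r = 0 it is affine and forces y = 0.\<close>

lemma psd_Cauchy_Schwarz:
  assumes X: "psd X"
  shows "(cmod (\<Sum>i\<in>UNIV. cnj (x $ i) * X $ i $ m))\<^sup>2 \<le> Re (X $ m $ m) * Re (cdot x (X *v x))"
proof -
  define y where "y = (\<Sum>i\<in>UNIV. cnj (x $ i) * X $ i $ m)"
  define r q where "r = Re (X $ m $ m)" and "q = Re (cdot x (X *v x))"
  have "0 \<le> q + 2 * Re (- of_real u * cnj y * y) + (cmod (- of_real u * cnj y))\<^sup>2 * r" for u
    using psd_shift[OF X, of x "- of_real u * cnj y" m] by (simp add: y_def q_def r_def)
  then have *: "0 \<le> q - 2 * u * (cmod y)\<^sup>2 + u\<^sup>2 * (cmod y)\<^sup>2 * r" for u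
    by (simp add: norm_mult power_mult_distrib mult.assoc complex_norm_square [symmetric] mult.commute[of "cnj y"])
  show "(cmod y)\<^sup>2 \<le> r * q"
  proof (cases "r = 0")
    case True
    have "y = 0"
    proof (rule ccontr)
      assume "y \<noteq> 0"
      \<comment> \<open>For r = 0 this choice of \<open>u\<close> makes the quadratic equal to
        -1.\<close>
      then show False
        using *[of "(q + 1) / (2 * (cmod y)\<^sup>2)"] True by simp
    qed
    then show ?thesis using True by simp
  next
    case False
    then have "r > 0" using psd_diag[OF X, of m] by (simp add: r_def)
    then show ?thesis
      using *[of "1 / r"] by (simp add: field_simps power2_eq_square)
  qed
qed

text \<open>Cholesky factorization: each step splits off a column and leaves the Schur complement.\<close>

lemma psd_imp_gram_aux:
  fixes X :: "complex ^ 'n ^ 'n"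
  assumes "finite S" "psd X" "\<And>i j. i \<notin> S \<Longrightarrow> X $ i $ j = 0"
  shows "\<exists>b :: 'n \<Rightarrow> complex ^ 'n. \<forall>i j. X $ i $ j = (\<Sum>k\<in>S. b k $ i * cnj (b k $ j))"
  using assms
proof (induction S arbitrary: X)
  case (insert m S)
  define r where "r = Re (X $ m $ m)"
  \<comment> \<open>If r = 0, division by zero yields u = 0 and nothing is split off.\<close>
  define u :: "complex ^ 'n" where "u = (\<chi> i. X $ i $ m / of_real (sqrt r))"
  define X' where "X' = (\<chi> i j. X $ i $ j - u $ i * cnj (u $ j))"
  have r: "0 \<le> r" "X $ m $ m = of_real r"
    using psd_diag[OF insert.prems(1), of m] by (simp_all add: r_def complex_eq_iff)
  note herm = psd_hermitian[OF insert.prems(1)]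
  have uu: "u $ i * cnj (u $ j) = X $ i $ m * X $ m $ j / of_real r" for i j
    using r(1) by (simp add: u_def herm[of m j] flip: of_real_mult)
  have "psd X'"
    unfolding psd_def
  proof (intro conjI allI)
    show "mat_dagger X' = X'"
      by (simp add: vec_eq_iff mat_dagger_def X'_def mult.commute herm[symmetric])
    fix x
    define y where "y = (\<Sum>i\<in>UNIV. cnj (x $ i) * X $ i $ m)"
    have y: "cdot x u = y / of_real (sqrt r)"
      by (simp add: y_def cdot_def u_def sum_divide_distrib)
    have "cdot x (X' *v x) = cdot x (X *v x) - cdot x u * cnj (cdot x u)"
      by (simp add: cdot_def matrix_vector_mult_def X'_def sum_subtractf sum_distrib_left sum_distrib_right algebra_simps)
        (rule sum.swap)
    also have "cdot x u * cnj (cdot x u) = of_real ((cmod y)\<^sup>2 / r)"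
      unfolding y using r(1) by (simp add: complex_norm_square [symmetric] flip: of_real_mult of_real_power)
    finally have "cdot x (X' *v x) = cdot x (X *v x) - of_real ((cmod y)\<^sup>2 / r)" .
    moreover have pos: "0 \<le> cdot x (X *v x)"
      using insert.prems(1) by (simp add: psd_def)
    moreover have "(cmod y)\<^sup>2 / r \<le> Re (cdot x (X *v x))"
    proof (cases "r = 0")
      case False
      have "(cmod y)\<^sup>2 \<le> r * Re (cdot x (X *v x))"
        using psd_Cauchy_Schwarz[OF insert.prems(1), of x m] by (simp only: y_def r_def)
      then show ?thesis
        using False r(1) by (simp add: pos_divide_le_eq mult.commute)
    qed (use pos in \<open>simp add: less_eq_complex_def\<close>)
    ultimately show "0 \<le> cdot x (X' *v x)"
      by (simp add: less_eq_complex_def)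
  qed
  \<comment> \<open>Row \<open>m\<close> is cancelled by \<open>u\<close> if r > 0; if r = 0, it
    vanishes already by Cauchy-Schwarz.\<close>
  moreover have "X' $ i $ j = 0" if "i \<notin> S" for i j
  proof (cases "i = m")
    case True
    have "X $ m $ j = 0" if "r = 0"
      using psd_Cauchy_Schwarz[OF insert.prems(1), of "axis j 1" m] that
      by (simp add: r_def axis_def if_distrib if_distribR herm[of m j] cong: if_cong)
    then show ?thesis
      using True r by (auto simp: X'_def uu)
  next
    case False
    then show ?thesis
      using that insert.prems(2)[of i] by (simp add: X'_def uu)
  qed
  ultimately obtain b where b: "\<And>i j. X' $ i $ j = (\<Sum>k\<in>S. b k $ i * cnj (b k $ j))"
    using insert.IH[of X'] by blast
  have "X $ i $ j = (\<Sum>k\<in>insert m S. (b(m := u)) k $ i * cnj ((b(m := u)) k $ j))" for i j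
  proof -
    have "X $ i $ j = u $ i * cnj (u $ j) + X' $ i $ j" by (simp add: X'_def)
    also have "X' $ i $ j = (\<Sum>k\<in>S. (b(m := u)) k $ i * cnj ((b(m := u)) k $ j))"
      unfolding b using insert.hyps by (intro sum.cong) auto
    finally show ?thesis using insert.hyps by simp
  qed
  then show ?case by blast
qed simp

text \<open>The \<open>b k\<close> are the vectors whose combination with independent standard
  complex Gaussian coefficients has covariance \<open>X\<close>.\<close>

lemma psd_imp_gram:
  fixes X :: "complex ^ 'n ^ 'n"
  assumes "psd X"
  obtains b :: "'n \<Rightarrow> complex ^ 'n" where
    "\<And>v. cdot v (X *v v) = of_real (\<Sum>k\<in>UNIV. (cmod (cdot v (b k)))\<^sup>2)"
    "trace X = of_real (\<Sum>k\<in>UNIV. (norm (b k))\<^sup>2)"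
proof -
  obtain b :: "'n \<Rightarrow> complex ^ 'n" where b: "\<And>i j. X $ i $ j = (\<Sum>k\<in>UNIV. b k $ i * cnj (b k $ j))"
    using psd_imp_gram_aux[of UNIV X] assms by auto
  show thesis
  proof (rule that)
    fix v
    have "cdot v (X *v v) = (\<Sum>i\<in>UNIV. \<Sum>j\<in>UNIV. \<Sum>k\<in>UNIV. cnj (v $ i) * b k $ i * cnj (cnj (v $ j) * b k $ j))"
      by (simp add: cdot_def matrix_vector_mult_def b sum_distrib_left sum_distrib_right mult_ac)
    also have "\<dots> = (\<Sum>k\<in>UNIV. \<Sum>i\<in>UNIV. \<Sum>j\<in>UNIV. cnj (v $ i) * b k $ i * cnj (cnj (v $ j) * b k $ j))"
      by (subst sum.swap, subst (2) sum.swap) (rule refl)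
    also have "\<dots> = (\<Sum>k\<in>UNIV. cdot v (b k) * cnj (cdot v (b k)))"
      by (simp add: cdot_def sum_product cnj_sum)
    finally show "cdot v (X *v v) = of_real (\<Sum>k\<in>UNIV. (cmod (cdot v (b k)))\<^sup>2)"
      by (simp add: complex_norm_square [symmetric])
  next
    have "trace X = (\<Sum>k\<in>UNIV. \<Sum>i\<in>UNIV. b k $ i * cnj (b k $ i))"
      unfolding trace_def b by (rule sum.swap)
    then show "trace X = of_real (\<Sum>k\<in>UNIV. (norm (b k))\<^sup>2)"
      by (simp add: complex_norm_square [symmetric] norm_vec_power2)
  qed
qed

section \<open>Gram matrices bounded by the identity\<close>

lemma cdot_self: "cdot x x = of_real ((norm x)\<^sup>2)"
  by (simp add: cdot_def norm_vec_power2 complex_norm_square [symmetric] mult.commute)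

lemma cdot_diff: "cdot v (x - y) = cdot v x - cdot v y"
  by (simp add: cdot_def algebra_simps sum_subtractf)

lemma gram_diag: "(V ** mat_dagger V) $ i $ i = of_real (\<Sum>k\<in>UNIV. (cmod (V $ i $ k))\<^sup>2)"
  by (simp add: matrix_matrix_mult_def mat_dagger_def complex_norm_square [symmetric])

lemma psd_gram: "psd (V ** mat_dagger V)"
  unfolding psd_def
proof (intro conjI allI)
  show "mat_dagger (V ** mat_dagger V) = V ** mat_dagger V"
    by (simp add: vec_eq_iff mat_dagger_def matrix_matrix_mult_def mult.commute)
  fix x
  have "cdot x (V *v y) = cdot (mat_dagger V *v x) y" for y
    by (simp add: cdot_def matrix_vector_mult_def mat_dagger_def sum_distrib_left sum_distrib_right mult_ac)
      (rule sum.swap)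
  then have "cdot x ((V ** mat_dagger V) *v x) = of_real ((norm (mat_dagger V *v x))\<^sup>2)"
    by (simp add: cdot_self flip: matrix_vector_mul_assoc)
  then show "0 \<le> cdot x ((V ** mat_dagger V) *v x)"
    by (simp add: less_eq_complex_def flip: of_real_power)
qed

text \<open>The diagonal of A^2 <= A in the Loewner order. With x = A e_i of squared norm b,
  Cauchy-Schwarz for the form \<open>A\<close> bounds b^2 by A_ii times the form at
  \<open>x\<close>, which is at most b.\<close>

lemma psd_le_1_row_norm_le:
  assumes psd: "psd A" and le: "A \<preceq>\<^sub>L mat 1"
  shows "(\<Sum>j\<in>UNIV. (cmod (A $ i $ j))\<^sup>2) \<le> Re (A $ i $ i)"
proof -
  define x where "x = (\<chi> j. A $ j $ i)"
  define b where "b = (\<Sum>j\<in>UNIV. (cmod (A $ i $ j))\<^sup>2)"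
  have "cmod (A $ j $ i) = cmod (A $ i $ j)" for j
    using psd_hermitian[OF psd, of j i] by simp
  then have x: "(norm x)\<^sup>2 = b"
    by (simp add: norm_vec_power2 x_def b_def)
  have "0 \<le> cdot x ((mat 1 - A) *v x)"
    using le by (simp add: loewner_le_def psd_def)
  also have "(mat 1 - A) *v x = x - A *v x"
    by (simp add: matrix_vector_mult_diff_rdistrib)
  also have "cdot x (x - A *v x) = of_real b - cdot x (A *v x)"
    by (simp only: cdot_diff cdot_self x)
  finally have "Re (cdot x (A *v x)) \<le> b"
    by (simp add: less_eq_complex_def)
  moreover have "(\<Sum>j\<in>UNIV. cnj (x $ j) * A $ j $ i) = of_real b"
    unfolding x [symmetric] cdot_self [symmetric] by (simp add: cdot_def x_def)
  then have "b\<^sup>2 \<le> Re (A $ i $ i) * Re (cdot x (A *v x))"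
    using psd_Cauchy_Schwarz[OF psd, of x i] by simp
  ultimately have "b * b \<le> Re (A $ i $ i) * b"
    using mult_left_mono[of _ b "Re (A $ i $ i)"] psd_diag(1)[OF psd, of i]
    by (fastforce simp: power2_eq_square)
  moreover have "0 \<le> b" by (simp add: b_def sum_nonneg)
  ultimately show ?thesis
    using psd_diag(1)[OF psd, of i] unfolding b_def[symmetric]
    by (metis less_eq_real_def mult_right_le_imp_le)
qed

section \<open>Lower bounds on the maximum\<close>

text \<open>Needed because \<open>ennreal\<close> truncates negative numbers to 0. With u = 1/(1+d),
  both ln ((1+d)/d) >= u and a^2/4 >= u a^2/4, which leaves u (1 - a/2)^2.\<close>

lemma expint_1_bound_nonneg:
  fixes d a :: real
  assumes "0 < d"
  shows "0 \<le> ln (1 + d) - ln d - a / (1 + d) + a\<^sup>2 / 4"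
proof -
  define u where "u = 1 / (1 + d)"
  have u: "0 \<le> u" "u \<le> 1" using assms by (auto simp: u_def)
  have "- (d / (1 + d) - 1) \<le> - ln (d / (1 + d))"
    using ln_le_minus_one[of "d / (1 + d)"] assms by simp
  then have "u \<le> ln (1 + d) - ln d"
    using assms by (simp add: u_def ln_div field_simps)
  moreover have "u * a\<^sup>2 \<le> a\<^sup>2"
    using mult_right_mono[OF u(2), of "a\<^sup>2"] by simp
  moreover have "u - u * a + u * a\<^sup>2 / 4 = u * (1 - a / 2)\<^sup>2"
    by (simp add: power2_eq_square algebra_simps)
  moreover have "0 \<le> u * (1 - a / 2)\<^sup>2"
    using u by simp
  moreover have "a / (1 + d) = u * a"
    by (simp add: u_def)
  ultimately show ?thesis
    by linarith
qed

text \<open>The Gaussian selection starts at \<open>h\<close> and uses a factorization of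
  \<open>X\<close>, of total variance 1 along each row. The divergent \<open>ln d\<close> cancels
  between the bounds at variances 0 and 1.\<close>

lemma ex_r_obj_ge:
  fixes V X :: "complex ^ 'n ^ 'n" and h :: "complex ^ 'n"
  defines "n \<equiv> real CARD('n)"
  assumes X: "psd X" "trace X = of_nat CARD('n)"
    and X1: "\<And>i. cdot (rowvec V i) (X *v rowvec V i) = 1"
    and c: "0 < c" and d: "0 < d"
  defines "a \<equiv> \<lambda>i. (cmod (cdot (rowvec V i) h))\<^sup>2"
  shows "0 < r_max V"
    and "n * ln c + n - c * (n + (norm h)\<^sup>2)
      + (\<Sum>i\<in>UNIV. - euler_mascheroni - ln (1 + d) + a i / (1 + d) - (a i)\<^sup>2 / 4) \<le> ln (r_max V)"
proof -
  obtain b :: "'n \<Rightarrow> complex ^ 'n" where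
    b: "\<And>v. cdot v (X *v v) = of_real (\<Sum>k\<in>UNIV. (cmod (cdot v (b k)))\<^sup>2)"
      "trace X = of_real (\<Sum>k\<in>UNIV. (norm (b k))\<^sup>2)"
    using psd_imp_gram[OF X(1)] by blast
  have b1: "(\<Sum>k\<in>UNIV. (cmod (cdot (rowvec V i) (b k)))\<^sup>2) = 1" for i
    using X1[of i] unfolding b by (metis of_real_eq_1_iff)
  have bn: "(\<Sum>k\<in>UNIV. (norm (b k))\<^sup>2) = n"
    using X(2) unfolding b n_def by (metis of_real_eq_iff of_real_of_nat_eq)
  define U where "U = (\<lambda>i. ln (1 + d) - ln d - a i / (1 + d) + (a i)\<^sup>2 / 4)"
  have U0: "0 \<le> U i" for i
    unfolding U_def by (rule expint_1_bound_nonneg[OF d])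
  have n: "0 < n" by (simp add: n_def)
  obtain y where y: "(\<Sum>i\<in>UNIV. expint d 0 ((cmod (cdot (rowvec V i) y))\<^sup>2)) + ennreal (c * (norm y)\<^sup>2)
      \<le> (\<Sum>i\<in>UNIV. expint d 1 (a i)) + ennreal (c * ((norm h)\<^sup>2 + n))"
    using ex_expint_le[of UNIV UNIV d c "\<lambda>_. 0" "rowvec V" b h] c d by (auto simp: b1 bn a_def)
  define z where "z = (\<lambda>i. (cmod (cdot (rowvec V i) y))\<^sup>2)"
  have "(\<Sum>i\<in>UNIV. expint d 1 (a i)) \<le> (\<Sum>i\<in>UNIV. ennreal (U i))"
    unfolding U_def using d by (intro sum_mono expint_1_le) (auto simp: a_def)
  then have "(\<Sum>i\<in>UNIV. expint d 0 (z i)) + ennreal (c * (norm y)\<^sup>2)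
      \<le> (\<Sum>i\<in>UNIV. ennreal (U i)) + ennreal (c * ((norm h)\<^sup>2 + n))"
    using y by (auto simp: z_def intro: order.trans add_mono)
  also have "\<dots> = ennreal ((\<Sum>i\<in>UNIV. U i) + c * ((norm h)\<^sup>2 + n))"
    using U0 c n by (subst ennreal_plus) (auto intro!: sum_nonneg simp: sum_ennreal)
  finally have le: "(\<Sum>i\<in>UNIV. expint d 0 (z i)) + ennreal (c * (norm y)\<^sup>2)
      \<le> ennreal ((\<Sum>i\<in>UNIV. U i) + c * ((norm h)\<^sup>2 + n))" .
  have fin: "expint d 0 (z i) < \<infinity>" for i
  proof -
    have "expint d 0 (z i) \<le> (\<Sum>i\<in>UNIV. expint d 0 (z i))"
      by (intro member_le_sum) auto
    also have "\<dots> \<le> (\<Sum>i\<in>UNIV. expint d 0 (z i)) + ennreal (c * (norm y)\<^sup>2)"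
      by simp
    also note le
    finally show ?thesis
      by (simp add: order.strict_trans1)
  qed
  define e where "e = (\<lambda>i. enn2real (expint d 0 (z i)))"
  have e: "expint d 0 (z i) = ennreal (e i)" "0 \<le> e i" for i
    using fin[of i] by (simp_all add: e_def)
  have z: "0 < z i" for i
  proof -
    have "z i \<noteq> 0"
      using fin[of i] expint_0_0[OF d] by auto
    then show ?thesis by (simp add: z_def)
  qed
  have "- euler_mascheroni - ln d - ln (z i) \<le> e i" for i
    using expint_0_ge[OF d z[of i]] d z[of i] e(2)[of i] unfolding e(1) by (simp add: ln_mult ennreal_le_iff)
  then have "(\<Sum>i\<in>UNIV. - euler_mascheroni - ln d - ln (z i)) \<le> (\<Sum>i\<in>UNIV. e i)"
    by (intro sum_mono)
  moreover have "(\<Sum>i\<in>UNIV. e i) + c * (norm y)\<^sup>2 \<le> (\<Sum>i\<in>UNIV. U i) + c * ((norm h)\<^sup>2 + n)"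
  proof -
    have "ennreal ((\<Sum>i\<in>UNIV. e i) + c * (norm y)\<^sup>2) \<le> ennreal ((\<Sum>i\<in>UNIV. U i) + c * ((norm h)\<^sup>2 + n))"
      using le c e(2) by (simp add: e(1) sum_ennreal sum_nonneg)
    then show ?thesis
      using U0 c n by (subst (asm) ennreal_le_iff) (auto intro!: add_nonneg_nonneg sum_nonneg)
  qed
  ultimately have z_ge: "(\<Sum>i\<in>UNIV. - euler_mascheroni - ln d - U i) + c * (norm y)\<^sup>2 - c * ((norm h)\<^sup>2 + n)
      \<le> (\<Sum>i\<in>UNIV. ln (z i))"
    by (simp add: sum_subtractf)
  have y0: "y \<noteq> 0"
    using z[of undefined] by (auto simp: z_def cdot_def)
  define N where "N = (norm y)\<^sup>2 / n"
  have N: "0 < N" using y0 n by (simp add: N_def)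
  have ro: "r_obj V y = (\<Prod>i\<in>UNIV. z i)"
    by (simp add: r_obj_def z_def)
  have ro0: "0 < r_obj V y"
    using z by (simp add: ro prod_pos)
  have le_r: "r_obj V y \<le> r_max V * N ^ CARD('n)"
    using r_obj_le_r_max[OF y0, of V] by (simp add: N_def n_def)
  then show r: "0 < r_max V"
    using ro0 N by (metis less_le_trans zero_less_mult_pos2 zero_less_power)
  have "(\<Sum>i\<in>UNIV. ln (z i)) = ln (r_obj V y)"
    unfolding ro using z by (subst ln_prod) (simp_all add: order_less_imp_not_eq2[OF z])
  also have "\<dots> \<le> ln (r_max V * N ^ CARD('n))"
    using le_r ro0 by simp
  also have "\<dots> = ln (r_max V) + n * ln N"
    using r N by (simp add: ln_mult ln_realpow n_def)
  \<comment> \<open>The tangent line of the logarithm at 1/c; it makes the norm enter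
    linearly.\<close>
  also have "n * ln N \<le> n * (c * N - 1 - ln c)"
    using ln_le_minus_one[of "c * N"] c N n by (intro mult_left_mono) (auto simp: ln_mult)
  also have "n * (c * N - 1 - ln c) = c * (norm y)\<^sup>2 - n - n * ln c"
    using n by (simp add: N_def algebra_simps)
  finally have "(\<Sum>i\<in>UNIV. ln (z i)) \<le> ln (r_max V) + (c * (norm y)\<^sup>2 - n - n * ln c)"
    by simp
  moreover have "(\<Sum>i\<in>UNIV. - euler_mascheroni - ln d - U i)
      = (\<Sum>i\<in>UNIV. - euler_mascheroni - ln (1 + d) + a i / (1 + d) - (a i)\<^sup>2 / 4)"
    by (intro sum.cong) (auto simp: U_def)
  ultimately show "n * ln c + n - c * (n + (norm h)\<^sup>2)
      + (\<Sum>i\<in>UNIV. - euler_mascheroni - ln (1 + d) + a i / (1 + d) - (a i)\<^sup>2 / 4) \<le> ln (r_max V)"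
    using z_ge by (simp add: algebra_simps)
qed

text \<open>The cutoff \<open>d\<close> is sent to 0 from the right.\<close>

lemma ln_r_max_ge:
  fixes V X :: "complex ^ 'n ^ 'n"
  defines "n \<equiv> real CARD('n)"
  assumes X: "psd X" "trace X = of_nat CARD('n)"
    and X1: "\<And>i. cdot (rowvec V i) (X *v rowvec V i) = 1"
    and c: "0 < c"
  defines "a \<equiv> \<lambda>i h. (cmod (cdot (rowvec V i) h))\<^sup>2"
  shows "n * ln c + n - c * (n + (norm h)\<^sup>2)
      + (\<Sum>i\<in>UNIV. - euler_mascheroni + a i h - (a i h)\<^sup>2 / 4) \<le> ln (r_max V)"
proof (rule tendsto_upperbound)
  let ?f = "\<lambda>d. n * ln c + n - c * (n + (norm h)\<^sup>2)
      + (\<Sum>i\<in>UNIV. - euler_mascheroni - ln (1 + d) + a i h / (1 + d) - (a i h)\<^sup>2 / 4)"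
  have "(?f \<longlongrightarrow> n * ln c + n - c * (n + (norm h)\<^sup>2)
      + (\<Sum>i\<in>UNIV. - euler_mascheroni - ln (1 + 0) + a i h / (1 + 0) - (a i h)\<^sup>2 / 4)) (at_right 0)"
    by (intro tendsto_intros) auto
  then show "(?f \<longlongrightarrow> n * ln c + n - c * (n + (norm h)\<^sup>2)
      + (\<Sum>i\<in>UNIV. - euler_mascheroni + a i h - (a i h)\<^sup>2 / 4)) (at_right 0)"
    by simp
  show "\<forall>\<^sub>F d in at_right 0. ?f d \<le> ln (r_max V)"
    using eventually_at_right_less[of "0::real"]
    by eventually_elim (unfold a_def n_def, rule ex_r_obj_ge(2)[OF X X1 c])
qed simp

section \<open>Averaging over fourth roots of unity\<close>

lemma sum_roots_square:
  "(cmod (w + x))\<^sup>2 + (cmod (w + \<i> * x))\<^sup>2 + (cmod (w - x))\<^sup>2 + (cmod (w - \<i> * x))\<^sup>2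
    = 4 * ((cmod w)\<^sup>2 + (cmod x)\<^sup>2)"
  unfolding cmod_power2 by (simp add: power2_eq_square algebra_simps)

text \<open>Over the four roots \<epsilon> the cross term 2 Re (cnj w * \<epsilon> x) averages to 0
  and its square to 2 |w|^2 |x|^2. The two signs alone would not give the latter.\<close>

lemma sum_roots_quartic:
  "(cmod (w + x)) ^ 4 + (cmod (w + \<i> * x)) ^ 4 + (cmod (w - x)) ^ 4 + (cmod (w - \<i> * x)) ^ 4
    = 4 * ((cmod w) ^ 4 + 4 * (cmod w)\<^sup>2 * (cmod x)\<^sup>2 + (cmod x) ^ 4)"
proof -
  have 4: "cmod u ^ 4 = ((Re u)\<^sup>2 + (Im u)\<^sup>2)\<^sup>2" for u
    by (simp flip: cmod_power2 power_mult)
  show ?thesis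
    unfolding 4 cmod_power2 by simp algebra
qed

text \<open>
  The right-hand side is the expectation of the left-hand side over independent uniform
  fourth roots of unity \<open>e\<^sub>j\<close>.
\<close>

lemma ex_phases_le:
  fixes x :: "'i \<Rightarrow> 'j \<Rightarrow> complex" and p q :: "'i \<Rightarrow> real"
  assumes "finite S"
  shows "\<exists>e. (\<Sum>i\<in>I. p i * (cmod (w i + (\<Sum>j\<in>S. x i j * e j)))\<^sup>2 + q i * (cmod (w i + (\<Sum>j\<in>S. x i j * e j))) ^ 4)
    \<le> (\<Sum>i\<in>I. p i * ((cmod (w i))\<^sup>2 + (\<Sum>j\<in>S. (cmod (x i j))\<^sup>2))
        + q i * (cmod (w i) ^ 4 + 4 * (cmod (w i))\<^sup>2 * (\<Sum>j\<in>S. (cmod (x i j))\<^sup>2)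
          + 2 * (\<Sum>j\<in>S. (cmod (x i j))\<^sup>2)\<^sup>2 - (\<Sum>j\<in>S. cmod (x i j) ^ 4)))"
  using assms
proof (induction S arbitrary: w)
  case (insert j S)
  define M2 where "M2 = (\<lambda>i. \<Sum>j\<in>S. (cmod (x i j))\<^sup>2)"
  define M4 where "M4 = (\<lambda>i. \<Sum>j\<in>S. cmod (x i j) ^ 4)"
  \<comment> \<open>The expectation over the phases in \<open>S\<close>, given the partial sum
    \<open>u\<close>.\<close>
  define F where "F = (\<lambda>i u. p i * ((cmod u)\<^sup>2 + M2 i)
    + q i * (cmod u ^ 4 + 4 * (cmod u)\<^sup>2 * M2 i + 2 * (M2 i)\<^sup>2 - M4 i))"
  define P where "P = (\<lambda>z. \<Sum>i\<in>I. F i (w i + x i j * z))"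
  define R where "R = (\<Sum>i\<in>I. p i * ((cmod (w i))\<^sup>2 + ((cmod (x i j))\<^sup>2 + M2 i))
        + q i * (cmod (w i) ^ 4 + 4 * (cmod (w i))\<^sup>2 * ((cmod (x i j))\<^sup>2 + M2 i)
          + 2 * ((cmod (x i j))\<^sup>2 + M2 i)\<^sup>2 - (cmod (x i j) ^ 4 + M4 i)))"
  have F4: "F i (u + y) + F i (u + \<i> * y) + F i (u - y) + F i (u - \<i> * y)
      = 4 * (p i * ((cmod u)\<^sup>2 + ((cmod y)\<^sup>2 + M2 i))
        + q i * (cmod u ^ 4 + 4 * (cmod u)\<^sup>2 * ((cmod y)\<^sup>2 + M2 i)
          + 2 * ((cmod y)\<^sup>2 + M2 i)\<^sup>2 - (cmod y ^ 4 + M4 i)))" (is "?l = ?r") for i u y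
  proof -
    have "?l = p i * (((cmod (u + y))\<^sup>2 + (cmod (u + \<i> * y))\<^sup>2 + (cmod (u - y))\<^sup>2 + (cmod (u - \<i> * y))\<^sup>2) + 4 * M2 i)
      + q i * ((cmod (u + y) ^ 4 + cmod (u + \<i> * y) ^ 4 + cmod (u - y) ^ 4 + cmod (u - \<i> * y) ^ 4)
        + 4 * ((cmod (u + y))\<^sup>2 + (cmod (u + \<i> * y))\<^sup>2 + (cmod (u - y))\<^sup>2 + (cmod (u - \<i> * y))\<^sup>2) * M2 i
        + 8 * (M2 i)\<^sup>2 - 4 * M4 i)"
      unfolding F_def by (simp add: algebra_simps)
    also have "\<dots> = ?r"
      unfolding sum_roots_square sum_roots_quartic by (simp add: power2_eq_square power4_eq_xxxx algebra_simps)
    finally show ?thesis .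
  qed
  have "P 1 + P \<i> + P (- 1) + P (- \<i>) = 4 * R"
    unfolding P_def R_def sum_distrib_left sum.distrib [symmetric] F4 [symmetric]
    by (intro sum.cong) (auto simp: mult.commute)
  \<comment> \<open>One of the four roots does no worse than their average.\<close>
  then obtain z where z: "P z \<le> R"
    by (smt (verit))
  obtain e where e: "(\<Sum>i\<in>I. p i * (cmod (w i + x i j * z + (\<Sum>j\<in>S. x i j * e j)))\<^sup>2
      + q i * (cmod (w i + x i j * z + (\<Sum>j\<in>S. x i j * e j))) ^ 4) \<le> P z"
    using insert.IH[of "\<lambda>i. w i + x i j * z"] unfolding P_def F_def M2_def M4_def by blast
  have "(\<Sum>k\<in>S. x i k * (e(j := z)) k) = (\<Sum>k\<in>S. x i k * e k)" for i
    using insert.hyps by (intro sum.cong) auto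
  then have eq: "w i + (\<Sum>k\<in>insert j S. x i k * (e(j := z)) k) = w i + x i j * z + (\<Sum>j\<in>S. x i j * e j)" for i
    using insert.hyps by (simp add: add_ac)
  have "(\<Sum>i\<in>I. p i * (cmod (w i + (\<Sum>k\<in>insert j S. x i k * (e(j := z)) k)))\<^sup>2
      + q i * (cmod (w i + (\<Sum>k\<in>insert j S. x i k * (e(j := z)) k))) ^ 4) \<le> R"
    unfolding eq using e z by (rule order.trans)
  then show ?case
    unfolding R_def M2_def M4_def using insert.hyps
    by (intro exI[of _ "e(j := z)"]) (simp del: fun_upd_apply)
qed simp

text \<open>\<open>0.8165\<close> approximates the critical point \<open>sqrt (2 / 3)\<close> of \<open>2 a - a ^ 3\<close>.\<close>

lemma quartic_bound:
  fixes a :: real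
  assumes "0 \<le> a" "a \<le> 1"
  shows "2 * a\<^sup>2 - a ^ 4 \<le> 1.092 * a"
proof -
  have eq: "(a - r)\<^sup>2 * (a + 2 * r) = a ^ 3 - 3 * r\<^sup>2 * a + 2 * r ^ 3" for r
    by (simp add: power2_eq_square power3_eq_cube algebra_simps)
  have "0 \<le> (a - 0.8165)\<^sup>2 * (a + 2 * 0.8165)"
    using assms by simp
  then have "0 \<le> a ^ 3 - 3 * 0.8165\<^sup>2 * a + 2 * 0.8165 ^ 3"
    unfolding eq .
  \<comment> \<open>The critical point was rounded up so that this holds.\<close>
  moreover have "2 * a \<le> 3 * 0.8165\<^sup>2 * a"
    using assms by (intro mult_right_mono) (simp_all add: power2_eq_square)
  moreover have "2 * 0.8165 ^ 3 \<le> (1.092 :: real)"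
    by (simp add: power3_eq_cube)
  ultimately have "2 * a - a ^ 3 \<le> 1.092"
    by linarith
  from mult_right_mono[OF this assms(1)] show ?thesis
    by (simp add: power2_eq_square power3_eq_cube power4_eq_xxxx algebra_simps)
qed

theorem lemma1p4:
  fixes V A X :: "complex ^ 'n ^ 'n" and \<beta> n t :: real
  assumes n: "n = real CARD('n)"
    and A: "A = V ** mat_dagger V"
    and A_le: "A \<preceq>\<^sub>L mat 1"
    and X_max: "sdp_maximizer V X"
    and X_one: "\<And>i. cdot (rowvec V i) (X *v rowvec V i) = 1"
    and t: "t = Re (trace A)"
    and \<beta>: "0 \<le> \<beta>" "\<beta> < 1"
  shows "permanent A \<ge> complex_of_real (exp (- n) * r_max V)
    \<and> exp (- n) * r_max V \<ge> exp (- (euler_mascheroni + 1) * n) *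
        exp (n * (ln (1 - \<beta>) + \<beta> / (1 - \<beta>) * (t / n)
                  - 0.273 * \<beta>\<^sup>2 / (1 - \<beta>)\<^sup>2 * (n / t)))"
proof
  show "permanent A \<ge> complex_of_real (exp (- n) * r_max V)"
    unfolding n A by (rule permanent_ge_r_max)
next
  have X: "psd X" "trace X = of_nat CARD('n)"
    using X_max by (auto simp: sdp_maximizer_def is_arg_max_def sdp_feasible_def)
  have n0: "0 < n" by (simp add: n)
  define a where "a = (\<lambda>i. Re (A $ i $ i))"
  define b where "b = (\<lambda>i. \<Sum>j\<in>UNIV. (cmod (A $ i $ j))\<^sup>2)"
  define m where "m = (\<lambda>i. \<Sum>j\<in>UNIV. cmod (A $ i $ j) ^ 4)"
  have a_eq: "a i = (\<Sum>k\<in>UNIV. (cmod (V $ i $ k))\<^sup>2)" and cmod_a: "cmod (A $ i $ i) = a i" for i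
    unfolding a_def A gram_diag by (simp_all add: sum_nonneg del: of_real_sum)
  have a_pos: "0 < a i" for i
  proof (rule ccontr)
    assume "\<not> 0 < a i"
    moreover have "0 \<le> a i" by (simp add: a_eq sum_nonneg)
    ultimately have "a i = 0" by simp
    then have "rowvec V i = 0"
      by (simp add: a_eq sum_nonneg_eq_0_iff rowvec_def vec_eq_iff)
    then show False
      using X_one[of i] by (simp add: cdot_def)
  qed
  have t_eq: "t = (\<Sum>i\<in>UNIV. a i)"
    by (simp add: t trace_def a_def)
  have t0: "0 < t"
    unfolding t_eq using a_pos by (intro sum_pos) auto
  have ba: "b i \<le> a i" for i
    unfolding a_def b_def using psd_le_1_row_norm_le[OF _ A_le] psd_gram[of V] by (simp add: A)
  have ab: "(a i)\<^sup>2 \<le> b i" and am: "a i ^ 4 \<le> m i" for i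
    unfolding b_def m_def cmod_a [symmetric] by (intro member_le_sum; simp)+
  have a1: "a i \<le> 1" for i
    using order.trans[OF ab[of i] ba[of i]] a_pos[of i] by (simp add: power2_eq_square)
  \<comment> \<open>\<open>g\<close> is the squared scale of \<open>h\<close>, chosen to give it
    mean squared norm g t = s n. The mean normalized squared norm of G + h is then 1 + s = 1/c, the
    tangent point of the logarithm.\<close>
  define c s g where "c = 1 - \<beta>" and "s = \<beta> / (1 - \<beta>)" and "g = s * n / t"
  have c: "0 < c" "c * s = \<beta>" using \<beta> by (simp_all add: c_def s_def)
  have s0: "0 \<le> s" using \<beta> by (simp add: s_def)
  have g0: "0 \<le> g" using s0 n0 t0 by (simp add: g_def)
  have gt: "g * t = s * n" using t0 by (simp add: g_def)
  have sum_Plus: "(\<Sum>x\<in>UNIV. f x) = (\<Sum>i\<in>UNIV. f (Inl i)) + (\<Sum>k\<in>UNIV. f (Inr k))"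
    for f :: "'n + 'n \<Rightarrow> real"
    using sum.Plus[of UNIV UNIV f] by simp
  \<comment> \<open>A single choice of phases must control both the values along the rows and the
    norm of \<open>h\<close>, so the two families are joined over the index type
    \<open>'n + 'n\<close>: left for the rows, right for the coordinates of
    \<open>h\<close>.\<close>
  obtain e where e: "(\<Sum>i\<in>UNIV. - g * (cmod (\<Sum>j\<in>UNIV. A $ i $ j * e j))\<^sup>2
        + g\<^sup>2 / 4 * (cmod (\<Sum>j\<in>UNIV. A $ i $ j * e j)) ^ 4)
      + (\<Sum>k\<in>UNIV. c * g * (cmod (\<Sum>j\<in>UNIV. cnj (V $ j $ k) * e j))\<^sup>2)
      \<le> (\<Sum>i\<in>UNIV. - g * b i + g\<^sup>2 / 4 * (2 * (b i)\<^sup>2 - m i))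
      + (\<Sum>k\<in>UNIV. c * g * (\<Sum>j\<in>UNIV. (cmod (V $ j $ k))\<^sup>2))"
    using ex_phases_le[where S = "UNIV :: 'n set" and I = UNIV and w = "\<lambda>_. 0"
        and p = "case_sum (\<lambda>_ :: 'n. - g) (\<lambda>_ :: 'n. c * g)" and q = "case_sum (\<lambda>_. g\<^sup>2 / 4) (\<lambda>_. 0)"
        and x = "case_sum (\<lambda>i j. A $ i $ j) (\<lambda>k j. cnj (V $ j $ k))"]
    by (auto simp: b_def m_def sum_Plus)
  define u where "u = (\<lambda>i. \<Sum>j\<in>UNIV. A $ i $ j * e j)"
  define h :: "complex ^ 'n" where "h = (\<chi> k. of_real (sqrt g) * (\<Sum>j\<in>UNIV. cnj (V $ j $ k) * e j))"
  have h_norm: "(norm h)\<^sup>2 = (\<Sum>k\<in>UNIV. g * (cmod (\<Sum>j\<in>UNIV. cnj (V $ j $ k) * e j))\<^sup>2)"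
    using g0 by (simp add: norm_vec_power2 h_def norm_mult power_mult_distrib)
  have "cdot (rowvec V i) h = of_real (sqrt g) * u i" for i
  proof -
    have "cdot (rowvec V i) h = of_real (sqrt g) * (\<Sum>k\<in>UNIV. \<Sum>j\<in>UNIV. V $ i $ k * cnj (V $ j $ k) * e j)"
      by (simp add: cdot_rowvec matrix_vector_mult_def h_def sum_distrib_left mult_ac)
    also have "(\<Sum>k\<in>UNIV. \<Sum>j\<in>UNIV. V $ i $ k * cnj (V $ j $ k) * e j) = u i"
      by (subst sum.swap) (simp add: u_def A matrix_matrix_mult_def mat_dagger_def sum_distrib_right)
    finally show ?thesis .
  qed
  then have h_cdot: "(cmod (cdot (rowvec V i) h))\<^sup>2 = g * (cmod (u i))\<^sup>2" for i
    using g0 by (simp add: norm_mult power_mult_distrib)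
  have Vt: "(\<Sum>k\<in>UNIV. c * g * (\<Sum>j\<in>UNIV. (cmod (V $ j $ k))\<^sup>2)) = \<beta> * n"
  proof -
    have "(\<Sum>k\<in>UNIV. \<Sum>j\<in>UNIV. (cmod (V $ j $ k))\<^sup>2) = t"
      unfolding t_eq a_eq by (rule sum.swap)
    then have "(\<Sum>k\<in>UNIV. c * g * (\<Sum>j\<in>UNIV. (cmod (V $ j $ k))\<^sup>2)) = c * (g * t)"
      by (simp flip: sum_distrib_left)
    then show ?thesis
      using c(2) by (simp add: gt flip: mult.assoc)
  qed
  have "n * ln c + n - c * (n + (norm h)\<^sup>2)
      + (\<Sum>i\<in>UNIV. - euler_mascheroni + g * (cmod (u i))\<^sup>2 - (g * (cmod (u i))\<^sup>2)\<^sup>2 / 4) \<le> ln (r_max V)"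
    using ln_r_max_ge[OF X X_one c(1), of h] by (simp add: h_cdot n)
  moreover have "(\<Sum>i\<in>UNIV. - euler_mascheroni + g * (cmod (u i))\<^sup>2 - (g * (cmod (u i))\<^sup>2)\<^sup>2 / 4)
      = - (\<Sum>i\<in>UNIV. - g * (cmod (u i))\<^sup>2 + g\<^sup>2 / 4 * (cmod (u i)) ^ 4) - euler_mascheroni * n"
    by (simp add: n sum.distrib sum_subtractf sum_negf power_mult_distrib flip: power_mult)
  moreover have "c * (norm h)\<^sup>2 = (\<Sum>k\<in>UNIV. c * g * (cmod (\<Sum>j\<in>UNIV. cnj (V $ j $ k) * e j))\<^sup>2)"
    by (simp add: h_norm sum_distrib_left mult.assoc)
  moreover have "c * n + \<beta> * n = n"
    by (simp add: c_def algebra_simps)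
  moreover have "c * (n + (norm h)\<^sup>2) = c * n + c * (norm h)\<^sup>2"
    by (rule distrib_left)
  moreover have "(\<Sum>i\<in>UNIV. - g * (cmod (u i))\<^sup>2 + g\<^sup>2 / 4 * (cmod (u i)) ^ 4)
      + (\<Sum>k\<in>UNIV. c * g * (cmod (\<Sum>j\<in>UNIV. cnj (V $ j $ k) * e j))\<^sup>2)
      \<le> (\<Sum>i\<in>UNIV. - g * b i + g\<^sup>2 / 4 * (2 * (b i)\<^sup>2 - m i)) + \<beta> * n"
    using e unfolding u_def Vt .
  ultimately have r: "n * ln c - euler_mascheroni * n - (\<Sum>i\<in>UNIV. - g * b i + g\<^sup>2 / 4 * (2 * (b i)\<^sup>2 - m i))
      \<le> ln (r_max V)"
    by linarith
  \<comment> \<open>The quartic term uses b_i <= a_i and m_i >= a_i^4, the linear term b_i >= a_i^2;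
    the constant is 1.092 / 4.\<close>
  have "- g * b i + g\<^sup>2 / 4 * (2 * (b i)\<^sup>2 - m i) \<le> - g * (a i)\<^sup>2 + g\<^sup>2 * 0.273 * a i" for i
  proof -
    have "(b i)\<^sup>2 \<le> (a i)\<^sup>2"
      using ba[of i] order.trans[OF zero_le_power2 ab[of i]] by (intro power_mono)
    then have "2 * (b i)\<^sup>2 - m i \<le> 1.092 * a i"
      using am[of i] quartic_bound[of "a i"] a_pos[of i] a1[of i] by simp
    then have "g\<^sup>2 / 4 * (2 * (b i)\<^sup>2 - m i) \<le> g\<^sup>2 / 4 * (1.092 * a i)"
      by (intro mult_left_mono) auto
    moreover have "g * (a i)\<^sup>2 \<le> g * b i"
      using ab[of i] g0 by (rule mult_left_mono)
    ultimately show ?thesis by simp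
  qed
  then have "(\<Sum>i\<in>UNIV. - g * b i + g\<^sup>2 / 4 * (2 * (b i)\<^sup>2 - m i)) \<le> (\<Sum>i\<in>UNIV. - g * (a i)\<^sup>2 + g\<^sup>2 * 0.273 * a i)"
    by (intro sum_mono)
  also have "\<dots> = - g * (\<Sum>i\<in>UNIV. (a i)\<^sup>2) + g\<^sup>2 * 0.273 * t"
    by (simp only: sum.distrib t_eq sum_distrib_left)
  also have "g\<^sup>2 * 0.273 * t = 0.273 * s\<^sup>2 * n * (n / t)"
    using t0 by (simp add: g_def power2_eq_square mult_ac)
  also have "- g * (\<Sum>i\<in>UNIV. (a i)\<^sup>2) \<le> - s * t"
  proof -
    \<comment> \<open>Cauchy-Schwarz against the all-ones vector.\<close>
    have "t\<^sup>2 \<le> n * (\<Sum>i\<in>UNIV. (a i)\<^sup>2)"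
      using Cauchy_Schwarz_ineq_sum[of "\<lambda>_. 1" a UNIV] by (simp add: t_eq n)
    then have "s / t * t\<^sup>2 \<le> s / t * (n * (\<Sum>i\<in>UNIV. (a i)\<^sup>2))"
      using s0 t0 by (intro mult_left_mono) auto
    then show ?thesis
      using t0 by (simp add: g_def power2_eq_square)
  qed
  finally have "n * ln c - euler_mascheroni * n + s * t - 0.273 * s\<^sup>2 * n * (n / t) \<le> ln (r_max V)"
    using r by simp
  then have "exp (- n + (n * ln c - euler_mascheroni * n + s * t - 0.273 * s\<^sup>2 * n * (n / t)))
      \<le> exp (- n + ln (r_max V))"
    by simp
  also have "exp (- n + ln (r_max V)) = exp (- n) * r_max V"
    using ex_r_obj_ge(1)[OF X X_one zero_less_one zero_less_one] by (simp only: exp_add exp_ln)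
  also have "- n + (n * ln c - euler_mascheroni * n + s * t - 0.273 * s\<^sup>2 * n * (n / t))
      = - (euler_mascheroni + 1) * n + n * (ln c + s * (t / n) - 0.273 * s\<^sup>2 * (n / t))"
    using n0 by (simp add: algebra_simps)
  finally show "exp (- n) * r_max V \<ge> exp (- (euler_mascheroni + 1) * n) *
        exp (n * (ln (1 - \<beta>) + \<beta> / (1 - \<beta>) * (t / n)
                  - 0.273 * \<beta>\<^sup>2 / (1 - \<beta>)\<^sup>2 * (n / t)))"
    by (simp only: exp_add c_def s_def power_divide times_divide_eq_right)
qed

end
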